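(* Let $x_1,\dots,x_n$ be complex parameters such that no denominator below vanishes. Then $$\begin{aligned} \frac{1}{\pi_{q}} &=\frac{1}{1-q^{2}}\sum_{k_1,\dots,k_n\ge0}\ \prod_{1\leq r<s\leq n}\frac{1-q^{2k_{r}-2k_{s}}x_{r}/x_{s}}{1-x_{r}/x_{s}}\cdot\frac{(1-q^{4|\boldsymbol{k}|+1})(q;q^{2})_{|\boldsymbol{k}|}}{\prod_{r,s=1}^{n}(q^{2}x_{r}/x_{s};q^{2})_{k_{r}}}\\ &\quad\times(-1)^{n|\boldsymbol{k}|}q^{2\sum_{r=1}^{n}(r-1)k_{r}+2n\sum_{r=1}^{n}\binom{k_{r}}{2}-\frac{1}{4}}\prod_{r=1}^{n}x_{r}^{nk_{r}-|\boldsymbol{k}|}\\ &\quad\times\sum_{\substack{0\leq m_{r}\leq k_{r}\\ r=1,\dots,n}}\ \prod_{1\leq r<s\leq n}\frac{1-q^{2m_{r}-2m_{s}}x_{r}/x_{s}}{1-x_{r}/x_{s}}\prod_{r,s=1}^{n}\frac{(q^{-2k_{s}}x_{r}/x_{s};q^{2})_{m_{r}}}{(q^{2}x_{r}/x_{s};q^{2})_{m_{r}}}\cdot\frac{(q^{2|\boldsymbol{k}|+1},q;q^{2})_{|\boldsymbol{m}|}}{(q^{2},q^{2};q^{2})_{|\boldsymbol{m}|}}q^{2\sum_{r=1}^{n}rm_{r}}. \end{aligned}$$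
   Context: $q$ is a complex number with $0<|q|<1$, with a fixed choice of the fourth root $q^{1/4}$ (used consistently, $q^{-1/4}=1/q^{1/4}$), and $n\ge1$ is an integer. $(z;q^2)_\infty=\prod_{i\ge0}(1-zq^{2i})$, $(z;q^2)_k=\prod_{i=0}^{k-1}(1-zq^{2i})$, and $(c_1,\dots,c_p;q^2)_k=(c_1;q^2)_k\cdots(c_p;q^2)_k$. The $q$-analogue of $\pi$ is $$\pi_{q}:=(1-q^{2})q^{1/4}\frac{(q^{2};q^{2})_{\infty}^{2}}{(q;q^{2})_{\infty}^{2}}.$$ Bold letters denote multi-indices of nonnegative integers, $\boldsymbol k=(k_1,\dots,k_n)$, with $|\boldsymbol k|=k_1+\cdots+k_n$. *)

theory Defs
  imports "HOL-Analysis.Analysis"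
begin

definition qpoch :: "complex \<Rightarrow> complex \<Rightarrow> nat \<Rightarrow> complex" where
  "qpoch z p k = (\<Prod>i<k. 1 - z * p ^ i)"

definition qpoch_inf :: "complex \<Rightarrow> complex \<Rightarrow> complex" where
  "qpoch_inf z p = prodinf (\<lambda>i. 1 - z * p ^ i)"

(* The argument w is the chosen fourth root of q, i.e. w ^ 4 = q. *)
definition q_pi :: "complex \<Rightarrow> complex \<Rightarrow> complex" where
  "q_pi w q = (1 - q\<^sup>2) * w * (qpoch_inf (q\<^sup>2) (q\<^sup>2))\<^sup>2 / (qpoch_inf q (q\<^sup>2))\<^sup>2"

(* Multi-indices (k 1, ..., k n) are functions that are undefined outside {1..n}, so that
   each tuple of naturals is represented exactly once. *)
definition multi_indices :: "nat \<Rightarrow> (nat \<Rightarrow> nat) set" where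
  "multi_indices n = {1..n} \<rightarrow>\<^sub>E UNIV"

definition mi_size :: "nat \<Rightarrow> (nat \<Rightarrow> nat) \<Rightarrow> nat" where
  "mi_size n k = (\<Sum>r=1..n. k r)"

definition vandermonde_ratio ::
    "nat \<Rightarrow> complex \<Rightarrow> (nat \<Rightarrow> complex) \<Rightarrow> (nat \<Rightarrow> nat) \<Rightarrow> complex" where
  "vandermonde_ratio n q x k =
     (\<Prod>r=1..n. \<Prod>s=r+1..n.
        (1 - q powi (2 * int (k r) - 2 * int (k s)) * (x r / x s)) / (1 - x r / x s))"

definition inner_sum ::
    "nat \<Rightarrow> complex \<Rightarrow> (nat \<Rightarrow> complex) \<Rightarrow> (nat \<Rightarrow> nat) \<Rightarrow> complex" where
  "inner_sum n q x k =
     (\<Sum>m \<in> (\<Pi>\<^sub>E r\<in>{1..n}. {0..k r}).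
        vandermonde_ratio n q x m
        * (\<Prod>r=1..n. \<Prod>s=1..n.
             qpoch (q powi (- 2 * int (k s)) * (x r / x s)) (q\<^sup>2) (m r)
             / qpoch (q\<^sup>2 * (x r / x s)) (q\<^sup>2) (m r))
        * (qpoch (q ^ (2 * mi_size n k + 1)) (q\<^sup>2) (mi_size n m) * qpoch q (q\<^sup>2) (mi_size n m)
           / (qpoch (q\<^sup>2) (q\<^sup>2) (mi_size n m) * qpoch (q\<^sup>2) (q\<^sup>2) (mi_size n m)))
        * q ^ (2 * (\<Sum>r=1..n. r * m r)))"

(* The factor 1 / w is q powered to -1/4, where w is the chosen fourth root of q. *)
definition outer_term ::
    "nat \<Rightarrow> complex \<Rightarrow> complex \<Rightarrow> (nat \<Rightarrow> complex) \<Rightarrow> (nat \<Rightarrow> nat) \<Rightarrow> complex" where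
  "outer_term n w q x k =
     vandermonde_ratio n q x k
     * ((1 - q ^ (4 * mi_size n k + 1)) * qpoch q (q\<^sup>2) (mi_size n k)
        / (\<Prod>r=1..n. \<Prod>s=1..n. qpoch (q\<^sup>2 * (x r / x s)) (q\<^sup>2) (k r)))
     * (- 1) ^ (n * mi_size n k)
     * (q ^ (2 * (\<Sum>r=1..n. (r - 1) * k r) + 2 * n * (\<Sum>r=1..n. k r choose 2)) * (1 / w))
     * (\<Prod>r=1..n. x r powi (int (n * k r) - int (mi_size n k)))
     * inner_sum n q x k"

end

theory Submission
  imports Defs
begin

text \<open>
  Put \<open>p = q\<^sup>2\<close>. The inner summand depends on \<open>m\<close> only through \<open>|m|\<close>, apart from a factor whose sum over
  \<open>|m| = M\<close> is evaluated by Milne's fundamental theorem for \<open>A\<^sub>n\<close> series; hence the inner sum is its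
  \<open>n = 1\<close> analogue at \<open>|k|\<close>. A confluent case of the same theorem sums the remaining outer factor over
  \<open>|k| = K\<close>. What is left is a series in \<open>K\<close> whose partial sums have a closed form (the Bailey
  inversion for \<open>n = 1\<close>) converging, by Tannery's theorem and Euler's identity
  \<open>\<Sum>L. (-1)\<^sup>L p\<^bsup>L(L+1)/2\<^esup> / (p;p)\<^sub>L = (p;p)\<^sub>\<infinity>\<close>, to \<open>(q;p)\<^sub>\<infinity>\<^sup>2 / (p;p)\<^sub>\<infinity>\<^sup>2\<close>.
  Regrouping by \<open>|k|\<close> requires absolute convergence: the inner sum suffers massive cancellation, and the
  closed form of the partial sums shows that the terms of the \<open>n = 1\<close> series are \<open>O(p\<^sup>K)\<close>, which
  carries over to \<open>O(p\<^bsup>|k|\<^esup>)\<close> for the multiple series.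
\<close>

section \<open>Lagrange interpolation at zero\<close>

text \<open>The factor \<open>1 - x i / x u\<close> kills the summand \<open>i = u\<close> and
  cancels \<open>s = u\<close> from every other weight, so that \<open>u\<close> is lost as a
  node.\<close>

lemma lagrange_weight_drop:
  fixes x :: "'a \<Rightarrow> 'c::field"
  assumes "finite S" "u \<in> S" "inj_on x S" "\<And>i. i \<in> S \<Longrightarrow> x i \<noteq> 0"
  shows "(\<Sum>i\<in>S. (1 - x i / x u) * f i / (\<Prod>s\<in>S - {i}. 1 - x i / x s)) =
         (\<Sum>i\<in>S - {u}. f i / (\<Prod>s\<in>S - {u} - {i}. 1 - x i / x s))"
proof -
  let ?L = "\<lambda>S i. \<Prod>s\<in>S - {i}. 1 - x i / x s"
  have "(\<Sum>i\<in>S. (1 - x i / x u) * f i / ?L S i) = (\<Sum>i\<in>S - {u}. (1 - x i / x u) * f i / ?L S i)"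
    using assms by (subst sum.remove[of S u]) auto
  also have "\<dots> = (\<Sum>i\<in>S - {u}. f i / ?L (S - {u}) i)"
  proof (rule sum.cong[OF refl])
    fix i assume i: "i \<in> S - {u}"
    have "S - {i} - {u} = S - {u} - {i}" by blast
    then have "?L S i = (1 - x i / x u) * ?L (S - {u}) i"
      using i assms by (subst prod.remove[of _ u]) auto
    moreover have "1 - x i / x u \<noteq> 0"
      using i assms by (auto simp: divide_eq_eq inj_on_def)
    ultimately show "(1 - x i / x u) * f i / ?L S i = f i / ?L (S - {u}) i"
      by (simp only: mult_divide_mult_cancel_left not_False_eq_True)
  qed
  finally show ?thesis .
qed

text \<open>Each weight is a Lagrange basis polynomial for the nodes \<open>x s\<close>, evaluated
  at 0; the sum interpolates the constant 1.\<close>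

lemma lagrange_weights_sum:
  fixes x :: "'a \<Rightarrow> 'c::field"
  assumes "finite S" "S \<noteq> {}" "inj_on x S" "\<And>i. i \<in> S \<Longrightarrow> x i \<noteq> 0"
  shows "(\<Sum>i\<in>S. 1 / (\<Prod>s\<in>S - {i}. 1 - x i / x s)) = 1"
  using assms
proof (induction "card S" arbitrary: S rule: less_induct)
  case less
  let ?L = "\<lambda>S i. \<Prod>s\<in>S - {i}. 1 - x i / x s"
  obtain u where u: "u \<in> S" using less.prems by blast
  show ?case
  proof (cases "S = {u}")
    case False
    then obtain v where v: "v \<in> S" "u \<noteq> v" using u by blast
    have IH: "(\<Sum>i\<in>S. (1 - x i / x w) * 1 / ?L S i) = 1" if "w \<in> S" for w
    proof -
      have "S - {w} \<noteq> {}" using u v by blast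
      then show ?thesis
        using less.hyps[of "S - {w}"] less.prems that
        by (subst lagrange_weight_drop) (auto simp: inj_on_diff card_gt_0_iff)
    qed
    have ne: "x u \<noteq> x v" "x u \<noteq> 0" "x v \<noteq> 0" using u v less.prems by (auto simp: inj_on_def)
    have "1 / ?L S i = x u / (x u - x v) * ((1 - x i / x u) * 1 / ?L S i)
            - x v / (x u - x v) * ((1 - x i / x v) * 1 / ?L S i)" for i
    proof -
      \<comment> \<open>A combination of two factors, each of which drops one node and so leads to a
        smaller set.\<close>
      have "1 = x u / (x u - x v) * (1 - x i / x u) - x v / (x u - x v) * (1 - x i / x v)"
        using ne by (simp add: divide_simps)
      then show ?thesis by (metis (no_types, lifting) diff_divide_distrib mult.right_neutral times_divide_eq_right)
    qed
    then have "(\<Sum>i\<in>S. 1 / ?L S i) = (\<Sum>i\<in>S. x u / (x u - x v) * ((1 - x i / x u) * 1 / ?L S i)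
            - x v / (x u - x v) * ((1 - x i / x v) * 1 / ?L S i))"
      by (rule sum.cong[OF refl])
    also have "\<dots> = x u / (x u - x v) - x v / (x u - x v)"
      unfolding sum_subtractf sum_distrib_left[symmetric] using IH u v by simp
    also have "\<dots> = 1" using ne by (simp add: diff_divide_distrib[symmetric])
    finally show ?thesis .
  qed simp
qed

text \<open>The polynomial \<open>\<Prod>s\<in>T. b s - A s * z\<close> is interpolated at 0. This
  is exact below degree \<open>card S\<close>; in degree \<open>card S\<close> the error is the
  leading coefficient times the node polynomial at 0, and the signs of the two cancel.\<close>

lemma lagrange_sum:
  fixes A b :: "'b \<Rightarrow> 'c::field" and x :: "'a \<Rightarrow> 'c"
  assumes "finite T" "finite S" "card T \<le> card S" "inj_on x S" "\<And>i. i \<in> S \<Longrightarrow> x i \<noteq> 0"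
  shows "(\<Sum>i\<in>S. (\<Prod>s\<in>T. b s - A s * x i) / (\<Prod>s\<in>S - {i}. 1 - x i / x s)) =
         prod b T - (if card T = card S then prod A T * prod x S else 0)"
  using assms
proof (induction T arbitrary: S rule: finite_induct)
  case empty
  then show ?case
    using lagrange_weights_sum[of S x] by (cases "S = {}") auto
next
  case (insert t T)
  let ?L = "\<lambda>S i. \<Prod>s\<in>S - {i}. 1 - x i / x s"
  let ?P = "\<lambda>i. \<Prod>s\<in>T. b s - A s * x i"
  have "S \<noteq> {}" using insert by auto
  then obtain u where u: "u \<in> S" by blast
  have c: "card T < card S" "card S = Suc (card (S - {u}))"
    using insert u by (simp_all add: card_Suc_Diff1 del: card_Diff_insert)
  have pS: "prod x S = x u * prod x (S - {u})" using u insert by (simp add: prod.remove)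
  have IH1: "(\<Sum>i\<in>S. ?P i / ?L S i) = prod b T"
    using insert.IH[of S] insert.prems c by simp
  have IH2: "(\<Sum>i\<in>S - {u}. ?P i / ?L (S - {u}) i) =
         prod b T - (if card (insert t T) = card S then prod A T * prod x (S - {u}) else 0)"
    using insert.IH[of "S - {u}"] insert.prems insert.hyps c by (simp add: inj_on_diff)
  have "(\<Prod>s\<in>insert t T. b s - A s * x i) / ?L S i
      = (b t - A t * x u) * (?P i / ?L S i) + A t * x u * ((1 - x i / x u) * ?P i / ?L S i)" for i
  proof -
    \<comment> \<open>Splitting off the value at \<open>x u\<close> leaves a multiple of
      \<open>1 - x i / x u\<close>, which drops the node \<open>u\<close>. In both parts only
      \<open>T\<close> remains, and its degree still fits the number of nodes.\<close>
    have "b t - A t * x i = (b t - A t * x u) + A t * x u * (1 - x i / x u)"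
      using u insert.prems by (simp add: field_simps)
    then have "(\<Prod>s\<in>insert t T. b s - A s * x i) = ((b t - A t * x u) + A t * x u * (1 - x i / x u)) * ?P i"
      using insert.hyps by simp
    then show ?thesis by (simp add: add_divide_distrib distrib_right mult.assoc)
  qed
  then have "(\<Sum>i\<in>S. (\<Prod>s\<in>insert t T. b s - A s * x i) / ?L S i)
     = (\<Sum>i\<in>S. (b t - A t * x u) * (?P i / ?L S i) + A t * x u * ((1 - x i / x u) * ?P i / ?L S i))"
    by (rule sum.cong[OF refl])
  also have "\<dots> = (b t - A t * x u) * prod b T
      + A t * x u * (\<Sum>i\<in>S - {u}. ?P i / ?L (S - {u}) i)"
    unfolding sum.distrib sum_distrib_left[symmetric] IH1
    by (simp only: lagrange_weight_drop[OF insert.prems(1) u insert.prems(3,4)])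
  also have "\<dots> = prod b (insert t T) -
      (if card (insert t T) = card S then prod A (insert t T) * prod x S else 0)"
    unfolding IH2 pS using insert.hyps by (simp add: algebra_simps)
  finally show ?case .
qed

section \<open>Milne's fundamental theorem\<close>

definition vdm :: "nat \<Rightarrow> (nat \<Rightarrow> 'a::comm_ring_1) \<Rightarrow> 'a" where
  "vdm n y = (\<Prod>s=1..n. \<Prod>r=1..<s. y r - y s)"

lemma vdm_cong: "(\<And>r. r \<in> {1..n} \<Longrightarrow> y r = z r) \<Longrightarrow> vdm n y = vdm n z"
  unfolding vdm_def by (intro prod.cong) auto

lemma vdm_nonzero:
  fixes y :: "nat \<Rightarrow> 'a::idom"
  assumes "inj_on y {1..n}"
  shows "vdm n y \<noteq> 0"
proof -
  have "y r - y s \<noteq> 0" if "s \<in> {1..n}" "r \<in> {1..<s}" for r s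
    using inj_onD[OF assms, of r s] that by auto
  then show ?thesis by (simp add: vdm_def)
qed

lemma vdm_Suc: "vdm (Suc n) y = vdm n y * (\<Prod>r=1..n. y r - y (Suc n))"
  by (simp add: vdm_def atLeastLessThanSuc_atLeastAtMost)

text \<open>As a polynomial in \<open>c\<close> the Vandermonde product has the roots
  \<open>y s\<close> with \<open>s \<noteq> i\<close>. Leaving \<open>C\<close> unspecified avoids
  signs; it disappears in \<open>vdm_upd\<close> by comparison with \<open>c = y i\<close>.\<close>

lemma vdm_upd_factor:
  assumes "i \<in> {1..n}"
  shows "\<exists>C. \<forall>c. vdm n (y(i := c)) = C * (\<Prod>s\<in>{1..n} - {i}. c - y s)"
  using assms
proof (induction n)
  case (Suc n)
  show ?case
  proof (cases "i = Suc n")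
    case True
    have "vdm (Suc n) (y(i := c)) = vdm n y * (-1) ^ n * (\<Prod>s\<in>{1..Suc n} - {i}. c - y s)" for c
    proof -
      have 1: "{1..Suc n} - {i} = {1..n}" using True by auto
      have 2: "vdm n (y(i := c)) = vdm n y" using True by (intro vdm_cong) auto
      have "(\<Prod>r=1..n. (y(i := c)) r - (y(i := c)) (Suc n)) = (\<Prod>r=1..n. (-1) * (c - y r))"
        using True by (intro prod.cong) auto
      then show ?thesis unfolding vdm_Suc 1 2 by (simp only: prod.distrib prod_constant card_atLeastAtMost) simp
    qed
    then show ?thesis by blast
  next
    case False
    then have i: "i \<in> {1..n}" using Suc.prems by auto
    obtain C where C: "\<And>c. vdm n (y(i := c)) = C * (\<Prod>s\<in>{1..n} - {i}. c - y s)"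
      using Suc.IH[OF i] by blast
    have "vdm (Suc n) (y(i := c)) =
        C * (\<Prod>s\<in>{1..n} - {i}. y s - y (Suc n)) * (\<Prod>s\<in>{1..Suc n} - {i}. c - y s)" for c
    proof -
      have "{1..Suc n} - {i} = insert (Suc n) ({1..n} - {i})" using i by auto
      then have 1: "(\<Prod>s\<in>{1..Suc n} - {i}. c - y s) = (c - y (Suc n)) * (\<Prod>s\<in>{1..n} - {i}. c - y s)"
        by simp
      have 2: "(\<Prod>r=1..n. (y(i := c)) r - (y(i := c)) (Suc n))
          = (c - y (Suc n)) * (\<Prod>s\<in>{1..n} - {i}. y s - y (Suc n))"
        using i by (subst prod.remove[of _ i]) (auto intro!: arg_cong2[where f="(*)"] prod.cong)
      show ?thesis unfolding vdm_Suc C 1 2 by (simp only: mult_ac)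
    qed
    then show ?thesis by blast
  qed
qed simp

lemma vdm_upd:
  assumes "i \<in> {1..n}"
  shows "vdm n (y(i := c)) * (\<Prod>s\<in>{1..n} - {i}. y i - y s) = vdm n y * (\<Prod>s\<in>{1..n} - {i}. c - y s)"
proof -
  obtain C where C: "\<And>c. vdm n (y(i := c)) = C * (\<Prod>s\<in>{1..n} - {i}. c - y s)"
    using vdm_upd_factor[OF assms] by blast
  then have "vdm n (y(i := y i)) = C * (\<Prod>s\<in>{1..n} - {i}. y i - y s)" by blast
  then show ?thesis using C by (simp add: mult_ac)
qed

section \<open>Milne's summand and the shift of one node\<close>

lemma qpoch_0 [simp]: "qpoch z p 0 = 1"
  by (simp add: qpoch_def)

lemma qpoch_Suc: "qpoch z p (Suc k) = qpoch z p k * (1 - z * p ^ k)"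
  by (simp add: qpoch_def)

lemma qpoch_Suc_shift: "qpoch z p (Suc k) = (1 - z) * qpoch (z * p) p k"
  unfolding qpoch_def by (subst prod.lessThan_Suc_shift) (simp add: mult.assoc)

lemma qpoch_eq_0_iff: "qpoch z p k = 0 \<longleftrightarrow> (\<exists>i<k. z * p ^ i = 1)"
  by (auto simp: qpoch_def)

definition comps :: "nat \<Rightarrow> nat \<Rightarrow> (nat \<Rightarrow> nat) set" where
  "comps n N = {m \<in> multi_indices n. mi_size n m = N}"

definition milne_den :: "nat \<Rightarrow> complex \<Rightarrow> (nat \<Rightarrow> complex) \<Rightarrow> (nat \<Rightarrow> nat) \<Rightarrow> complex" where
  "milne_den n p x m = (\<Prod>r=1..n. \<Prod>s=1..n. qpoch (p * (x r / x s)) p (m r))"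

definition milne_num ::
    "nat \<Rightarrow> complex \<Rightarrow> (nat \<Rightarrow> complex) \<Rightarrow> (nat \<Rightarrow> complex) \<Rightarrow> (nat \<Rightarrow> complex) \<Rightarrow> (nat \<Rightarrow> nat) \<Rightarrow> complex" where
  "milne_num n p x A b m = (\<Prod>r=1..n. \<Prod>s=1..n. \<Prod>j<m r. b s - A s * (x r * p ^ j))"

text \<open>
  Milne's summand in homogeneous form: \<open>b = 1\<close>, \<open>A s = a s / x s\<close> gives the factors
  \<open>(a s x r / x s; p)\<close>, whereas \<open>b = 0\<close> gives their rescaled limit as all \<open>a s\<close> tend to infinity,
  so both inner and outer sum are covered by one identity.
\<close>

definition milne_term ::
    "nat \<Rightarrow> complex \<Rightarrow> (nat \<Rightarrow> complex) \<Rightarrow> (nat \<Rightarrow> complex) \<Rightarrow> (nat \<Rightarrow> complex) \<Rightarrow> (nat \<Rightarrow> nat) \<Rightarrow> complex" where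
  "milne_term n p x A b m =
     vdm n (\<lambda>r. x r * p ^ m r) / vdm n x * (milne_num n p x A b m / milne_den n p x m)"

text \<open>
  No quotient \<open>x r / x s\<close> with \<open>r \<noteq> s\<close> is an integral power of \<open>p\<close>; in this form the condition
  is visibly stable under \<open>x i \<mapsto> x i p\<close>.
\<close>

definition generic :: "nat \<Rightarrow> complex \<Rightarrow> (nat \<Rightarrow> complex) \<Rightarrow> bool" where
  "generic n p x \<longleftrightarrow> p \<noteq> 0 \<and> (\<forall>j>0. p ^ j \<noteq> 1) \<and> (\<forall>r\<in>{1..n}. x r \<noteq> 0) \<and>
     (\<forall>r\<in>{1..n}. \<forall>s\<in>{1..n}. \<forall>u v. r \<noteq> s \<longrightarrow> x r * p ^ u \<noteq> x s * p ^ v)"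

lemma generic_inj_on: "generic n p x \<Longrightarrow> inj_on (\<lambda>r. x r * p ^ m r) {1..n}"
  unfolding generic_def inj_on_def by blast

lemma generic_shift:
  assumes "generic n p x"
  shows "generic n p (x(i := x i * p))"
  unfolding generic_def
proof (intro conjI ballI allI impI)
  fix r s u v assume rs: "r \<in> {1..n}" "s \<in> {1..n}" "r \<noteq> s"
  have *: "(x(i := x i * p)) t * p ^ w = x t * p ^ (if t = i then Suc w else w)" for t w
    by simp
  show "(x(i := x i * p)) r * p ^ u \<noteq> (x(i := x i * p)) s * p ^ v"
    unfolding * using assms rs unfolding generic_def by blast
qed (use assms in \<open>auto simp: generic_def\<close>)

lemma generic_qpoch_nonzero:
  assumes "generic n p x" "r \<in> {1..n}" "s \<in> {1..n}"
  shows "qpoch (p * (x r / x s)) p k \<noteq> 0"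
proof -
  have "p * (x r / x s) * p ^ i \<noteq> 1" for i
  proof
    assume "p * (x r / x s) * p ^ i = 1"
    then have "x r * p ^ Suc i = x s * p ^ 0"
      using assms by (auto simp: generic_def field_simps)
    then show False using assms unfolding generic_def
      by (metis mult_cancel_left power_0 zero_less_Suc)
  qed
  then show ?thesis by (auto simp: qpoch_eq_0_iff)
qed

lemma milne_den_nonzero: "generic n p x \<Longrightarrow> milne_den n p x m \<noteq> 0"
  using generic_qpoch_nonzero by (auto simp: milne_den_def)

text \<open>In row \<open>i\<close> the factor with \<open>j = 0\<close> splits off, and the
  remaining ones belong to the node \<open>x i * p\<close>.\<close>

lemma milne_num_shift:
  assumes "i \<in> {1..n}"
  shows "milne_num n p x A b (m(i := Suc (m i))) =
         (\<Prod>s=1..n. b s - A s * x i) * milne_num n p (x(i := x i * p)) A b m"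
proof -
  let ?f = "\<lambda>r. \<Prod>s=1..n. \<Prod>j<m r. b s - A s * (x r * p ^ j)"
  have "milne_num n p x A b (m(i := Suc (m i))) =
      (\<Prod>s=1..n. \<Prod>j<Suc (m i). b s - A s * (x i * p ^ j)) * (\<Prod>r\<in>{1..n} - {i}. ?f r)"
    unfolding milne_num_def using assms by (subst prod.remove[of _ i]) auto
  moreover have "milne_num n p (x(i := x i * p)) A b m =
      (\<Prod>s=1..n. \<Prod>j<m i. b s - A s * (x i * p * p ^ j)) * (\<Prod>r\<in>{1..n} - {i}. ?f r)"
    unfolding milne_num_def using assms by (subst prod.remove[of _ i]) auto
  ultimately show ?thesis
    by (subst (asm) prod.lessThan_Suc_shift) (simp add: prod.distrib mult_ac)
qed

text \<open>Only row \<open>i\<close> and column \<open>i\<close> change. Row \<open>i\<close> gains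
  a first factor, the diagonal entry a last one, and in column \<open>i\<close> the two ways of
  peeling a factor off \<open>qpoch (x r / x i) p (Suc (m r))\<close> are compared.\<close>

lemma milne_den_shift:
  assumes g: "generic n p x" and i: "i \<in> {1..n}"
  shows "milne_den n p x (m(i := Suc (m i))) * (\<Prod>s\<in>{1..n} - {i}. 1 - x s / x i) =
         milne_den n p (x(i := x i * p)) m * (1 - p ^ Suc (m i)) *
         (\<Prod>s\<in>{1..n} - {i}. 1 - p ^ m s * (x s / x i)) * (\<Prod>s\<in>{1..n} - {i}. 1 - p * (x i / x s))"
proof -
  let ?I = "{1..n} - {i}"
  let ?q = "\<lambda>r s. qpoch (p * (x r / x s)) p (m r)"
  have p0: "p \<noteq> 0" and xi: "x i \<noteq> 0" using g i by (auto simp: generic_def)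
  have split: "(\<Prod>r=1..n. \<Prod>s=1..n. h r s) =
     h i i * (\<Prod>s\<in>?I. h i s) * (\<Prod>r\<in>?I. h r i) * (\<Prod>r\<in>?I. \<Prod>s\<in>?I. h r s)"
    for h :: "nat \<Rightarrow> nat \<Rightarrow> complex"
  proof -
    have "prod g {1..n} = g i * prod g ?I" for g :: "nat \<Rightarrow> complex"
      using prod.remove[OF _ i] by simp
    then show ?thesis by (simp only: prod.distrib mult_ac)
  qed
  have L: "milne_den n p x (m(i := Suc (m i))) =
      qpoch p p (Suc (m i)) * (\<Prod>s\<in>?I. qpoch (p * (x i / x s)) p (Suc (m i))) *
      (\<Prod>r\<in>?I. ?q r i) * (\<Prod>r\<in>?I. \<Prod>s\<in>?I. ?q r s)"
    unfolding milne_den_def split using xi by simp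
  have R: "milne_den n p (x(i := x i * p)) m =
      qpoch p p (m i) * (\<Prod>s\<in>?I. qpoch (p * (x i / x s) * p) p (m i)) *
      (\<Prod>r\<in>?I. qpoch (x r / x i) p (m r)) * (\<Prod>r\<in>?I. \<Prod>s\<in>?I. ?q r s)"
    unfolding milne_den_def split using xi p0 by (simp add: mult_ac)
  have swap: "a * b * (c * d) * u * e * v = a * d * w * e * b * z * c" if "u * v = w * z"
    for a b c d e u v w z :: complex
    using that by algebra
  have 1: "qpoch p p (Suc (m i)) = qpoch p p (m i) * (1 - p ^ Suc (m i))"
    by (simp add: qpoch_Suc)
  have 2: "(\<Prod>s\<in>?I. qpoch (p * (x i / x s)) p (Suc (m i))) =
      (\<Prod>s\<in>?I. 1 - p * (x i / x s)) * (\<Prod>s\<in>?I. qpoch (p * (x i / x s) * p) p (m i))"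
    by (simp add: qpoch_Suc_shift prod.distrib)
  have "?q r i * (1 - x r / x i) = qpoch (x r / x i) p (m r) * (1 - p ^ m r * (x r / x i))" for r
    using qpoch_Suc[of "x r / x i" p "m r"] qpoch_Suc_shift[of "x r / x i" p "m r"]
    by (simp add: mult_ac)
  then have 3: "(\<Prod>r\<in>?I. ?q r i) * (\<Prod>s\<in>?I. 1 - x s / x i) =
     (\<Prod>r\<in>?I. qpoch (x r / x i) p (m r)) * (\<Prod>s\<in>?I. 1 - p ^ m s * (x s / x i))"
    unfolding prod.distrib[symmetric] by (intro prod.cong) auto
  show ?thesis
    unfolding L R 1 2 by (rule swap[OF 3])
qed

text \<open>
  Both sides carry the numerator of a Lagrange interpolation formula for the nodes \<open>x i\<close>; dividing by
  the Lagrange weights and summing over \<open>i\<close> yields a recursion in \<open>|m|\<close>.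
\<close>

lemma milne_term_shift:
  assumes g: "generic n p x" and i: "i \<in> {1..n}" and m': "m' = m(i := Suc (m i))"
  shows "milne_term n p x A b m' * (\<Prod>s=1..n. p ^ m' s - x i / x s) =
         - ((\<Prod>s=1..n. b s - A s * x i) * milne_term n p (x(i := x i * p)) A b m)"
proof -
  let ?I = "{1..n} - {i}"
  let ?x = "x(i := x i * p)"
  have p0: "p \<noteq> 0" and x0: "\<And>s. s \<in> {1..n} \<Longrightarrow> x s \<noteq> 0" using g by (auto simp: generic_def)
  have g': "generic n p ?x" by (rule generic_shift[OF g])
  have inj: "inj_on x {1..n}" "inj_on ?x {1..n}"
    using generic_inj_on[OF g, of "\<lambda>_. 0"] generic_inj_on[OF g', of "\<lambda>_. 0"] by (simp_all add: fun_upd_def)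
  note nz = vdm_nonzero[OF inj(1)] vdm_nonzero[OF inj(2)] milne_den_nonzero[OF g] milne_den_nonzero[OF g']
  have V: "vdm n (\<lambda>r. x r * p ^ m' r) = vdm n (\<lambda>r. ?x r * p ^ m r)"
    using m' by (intro vdm_cong) auto
  have VX: "vdm n ?x * (\<Prod>s\<in>?I. x i - x s) = vdm n x * (\<Prod>s\<in>?I. x i * p - x s)"
    by (rule vdm_upd[OF i])
  have d1: "(\<Prod>s\<in>?I. x i - x s) = (\<Prod>s\<in>?I. x i) * (\<Prod>s\<in>?I. 1 - x s / x i)"
    unfolding prod.distrib[symmetric] using x0 i by (intro prod.cong) (auto simp: field_simps)
  have d2: "(\<Prod>s\<in>?I. x i * p - x s) = (\<Prod>s\<in>?I. - x s) * (\<Prod>s\<in>?I. 1 - p * (x i / x s))"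
    unfolding prod.distrib[symmetric] using x0 by (intro prod.cong) (auto simp: field_simps)
  have d3: "(\<Prod>s\<in>?I. - x s) * (\<Prod>s\<in>?I. p ^ m' s - x i / x s) = (\<Prod>s\<in>?I. x i) * (\<Prod>s\<in>?I. 1 - p ^ m s * (x s / x i))"
    unfolding prod.distrib[symmetric] using x0 i m' by (intro prod.cong) (auto simp: field_simps)
  \<comment> \<open>The factor \<open>s = i\<close> is \<open>p ^ Suc (m i) - 1\<close>; it cancels
    the diagonal factor of the denominator and produces the minus sign.\<close>
  have d4: "(\<Prod>s=1..n. p ^ m' s - x i / x s) = - (1 - p ^ Suc (m i)) * (\<Prod>s\<in>?I. p ^ m' s - x i / x s)"
    using i x0[OF i] m' by (subst prod.remove[of _ i]) auto
  have nz2: "(\<Prod>s\<in>?I. 1 - x s / x i) \<noteq> 0" "(\<Prod>s\<in>?I. 1 - p * (x i / x s)) \<noteq> 0" "(\<Prod>s\<in>?I. - x s) \<noteq> 0"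
    "(\<Prod>s\<in>?I. x i) \<noteq> 0"
  proof -
    have "1 - x s / x i \<noteq> 0" if "s \<in> ?I" for s
      using that i inj_onD[OF inj(1), of s i] x0[OF i] by auto
    then show "(\<Prod>s\<in>?I. 1 - x s / x i) \<noteq> 0" by auto
    have "1 - p * (x i / x s) \<noteq> 0" if "s \<in> ?I" for s
      using generic_qpoch_nonzero[OF g i, of s 1] that by (simp add: qpoch_def)
    then show "(\<Prod>s\<in>?I. 1 - p * (x i / x s)) \<noteq> 0" by simp
    show "(\<Prod>s\<in>?I. - x s) \<noteq> 0" "(\<Prod>s\<in>?I. x i) \<noteq> 0" using x0 i by auto
  qed
  \<comment> \<open>With a name for each product, \<open>e1\<close> to \<open>e3\<close> become
    polynomial identities between atoms, which \<open>algebra\<close> can combine.\<close>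
  define a1 where "a1 = (\<Prod>s\<in>?I. 1 - x s / x i)"
  define a2 where "a2 = (\<Prod>s\<in>?I. 1 - p * (x i / x s))"
  define a3 where "a3 = (\<Prod>s\<in>?I. - x s)"
  define a4 where "a4 = (\<Prod>s\<in>?I. x i)"
  define a5 where "a5 = (\<Prod>s\<in>?I. 1 - p ^ m s * (x s / x i))"
  define a6 where "a6 = (\<Prod>s\<in>?I. p ^ m' s - x i / x s)"
  define c where "c = 1 - p ^ Suc (m i)"
  define D where "D = milne_den n p x m'"
  define D' where "D' = milne_den n p ?x m"
  define V0 where "V0 = vdm n x"
  define V1 where "V1 = vdm n ?x"
  have e1: "D * a1 = D' * c * a5 * a2"
    using milne_den_shift[OF g i, of m] unfolding c_def D_def D'_def a1_def a5_def a2_def m' .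
  have e2: "V1 * (a4 * a1) = V0 * (a3 * a2)"
    using VX unfolding d1 d2 V0_def V1_def a1_def a2_def a3_def a4_def .
  have e3: "a3 * a6 = a4 * a5"
    using d3 unfolding a3_def a4_def a5_def a6_def .
  have nz': "a1 \<noteq> 0" "a2 \<noteq> 0" "a3 \<noteq> 0" "a4 \<noteq> 0" "V0 \<noteq> 0" "V1 \<noteq> 0" "D \<noteq> 0" "D' \<noteq> 0"
    using nz nz2 by (simp_all add: a1_def a2_def a3_def a4_def V0_def V1_def D_def D'_def)
  have "c * a6 * (V1 * D') = V0 * D"
  proof -
    have "a1 * a4 * a3 * a2 * (c * a6 * (V1 * D')) = a1 * a4 * a3 * a2 * (V0 * D)"
      using e1 e2 e3 by algebra
    then show ?thesis using nz' by simp
  qed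
  then have main: "c * a6 / (V0 * D) = 1 / (V1 * D')"
    using nz' by (simp add: field_simps)
  have "milne_term n p x A b m' * (\<Prod>s=1..n. p ^ m' s - x i / x s) =
     - (vdm n (\<lambda>r. ?x r * p ^ m r) * (\<Prod>s=1..n. b s - A s * x i) * milne_num n p ?x A b m *
       (c * a6 / (V0 * D)))"
    unfolding c_def[symmetric] milne_term_def d4 V V0_def[symmetric] D_def[symmetric] a6_def[symmetric]
    using milne_num_shift[OF i, of p x A b m] by (simp add: m')
  also have "\<dots> = - ((\<Prod>s=1..n. b s - A s * x i) * milne_term n p ?x A b m)"
    unfolding main milne_term_def V1_def[symmetric] D'_def[symmetric] by simp
  finally show ?thesis .
qed

section \<open>Sums over compositions and the induction on their size\<close>

lemma finite_comps: "finite (comps n N)"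
proof (rule finite_subset)
  show "comps n N \<subseteq> {1..n} \<rightarrow>\<^sub>E {..N}"
  proof
    fix m assume m: "m \<in> comps n N"
    have "m r \<le> N" if "r \<in> {1..n}" for r
      using member_le_sum[of r "{1..n}" m] that m by (auto simp: comps_def mi_size_def)
    then show "m \<in> {1..n} \<rightarrow>\<^sub>E {..N}"
      using m by (auto simp: comps_def multi_indices_def PiE_def Pi_def)
  qed
qed (auto intro: finite_PiE)

lemma mi_size_upd:
  assumes "i \<in> {1..n}" shows "mi_size n (m(i := Suc (m i))) = Suc (mi_size n m)"
  unfolding mi_size_def using assms by (simp add: sum.remove[of _ i])

lemma prod_power_mi_size: "(\<Prod>s=1..n. c ^ m s) = (c ^ mi_size n m :: 'a::comm_monoid_mult)"
  by (simp add: mi_size_def power_sum)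

text \<open>Compositions of \<open>Suc N\<close> with positive entry \<open>i\<close> arise from
  those of \<open>N\<close> by raising that entry; the second assumption discards all
  others.\<close>

lemma sum_comps_shift:
  assumes i: "i \<in> {1..n}" and z: "\<And>m. m \<in> comps n (Suc N) \<Longrightarrow> m i = 0 \<Longrightarrow> f m = 0"
  shows "(\<Sum>m\<in>comps n (Suc N). f m) = (\<Sum>m\<in>comps n N. f (m(i := Suc (m i))))"
proof -
  have "(\<Sum>m\<in>comps n (Suc N). f m) = (\<Sum>m\<in>{m \<in> comps n (Suc N). m i \<noteq> 0}. f m)"
    using z by (intro sum.mono_neutral_right) (auto simp: finite_comps)
  also have "\<dots> = (\<Sum>m\<in>comps n N. f (m(i := Suc (m i))))"
  proof (rule sum.reindex_bij_witness[where i = "\<lambda>m. m(i := Suc (m i))" and j = "\<lambda>m. m(i := m i - 1)"])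
    fix m assume m: "m \<in> {m \<in> comps n (Suc N). m i \<noteq> 0}"
    let ?m = "m(i := m i - 1)"
    show up: "?m(i := Suc (?m i)) = m" using m by auto
    have "Suc (mi_size n ?m) = Suc N"
      using mi_size_upd[OF i, of ?m] up m by (simp add: comps_def)
    then show "?m \<in> comps n N"
      using m i by (auto simp: comps_def multi_indices_def PiE_def extensional_def)
    show "f (?m(i := Suc (?m i))) = f m" by (simp only: up)
  next
    fix m assume m: "m \<in> comps n N"
    show "(m(i := Suc (m i)))(i := (m(i := Suc (m i))) i - 1) = m" by simp
    show "m(i := Suc (m i)) \<in> {m \<in> comps n (Suc N). m i \<noteq> 0}"
      using m i mi_size_upd[OF i, of m] by (auto simp: comps_def multi_indices_def PiE_def extensional_def)
  qed
  finally show ?thesis .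
qed

text \<open>Induction on \<open>N\<close> for all nodes at once, because the recursion moves a node.
  Interpolation is used twice: to write \<open>1 - p ^ Suc N\<close> as a sum over \<open>i\<close>,
  and to add up the shifted sums.\<close>

theorem milne_fundamental:
  assumes "generic n p x"
  shows "(\<Sum>m\<in>comps n N. milne_term n p x A b m) =
         (\<Prod>j<N. (\<Prod>s=1..n. b s) - (\<Prod>s=1..n. A s) * (\<Prod>s=1..n. x s) * p ^ j) / qpoch p p N"
  using assms
proof (induction N arbitrary: x)
  case 0
  have inj: "inj_on x {1..n}" using generic_inj_on[OF 0, of "\<lambda>_. 0"] by simp
  have "comps n 0 = {\<lambda>r\<in>{1..n}. 0}"
    by (auto simp: comps_def multi_indices_def mi_size_def PiE_def extensional_def fun_eq_iff)
  then show ?case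
    using vdm_nonzero[OF inj] vdm_cong[of n "\<lambda>r. x r * p ^ (\<lambda>r\<in>{1..n}. 0) r" x]
    by (simp add: milne_term_def milne_num_def milne_den_def)
next
  case (Suc N)
  let ?c = "\<lambda>i. \<Prod>s\<in>{1..n} - {i}. 1 - x i / x s"
  let ?B = "\<Prod>s=1..n. b s" and ?AX = "(\<Prod>s=1..n. A s) * (\<Prod>s=1..n. x s)"
  have x0: "\<And>s. s \<in> {1..n} \<Longrightarrow> x s \<noteq> 0" and p: "p ^ Suc N \<noteq> 1" using Suc.prems by (auto simp: generic_def)
  have inj: "inj_on x {1..n}" using generic_inj_on[OF Suc.prems, of "\<lambda>_. 0"] by simp
  have L: "(\<Sum>i=1..n. (\<Prod>s=1..n. b s - A s * x i) / ?c i) = prod b {1..n} - prod A {1..n} * prod x {1..n}" for A b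
    using lagrange_sum[of "{1..n}" "{1..n}" x b A] inj x0 by simp
  \<comment> \<open>Interpolation with \<open>b s = p ^ m s\<close> and \<open>A s = 1 / x s\<close>
    gives \<open>p ^ |m| - 1\<close>, which is the same for all \<open>m\<close> of size
    \<open>Suc N\<close>.\<close>
  have w: "(1 - p ^ Suc N) * milne_term n p x A b m =
      (\<Sum>i=1..n. - (milne_term n p x A b m * (\<Prod>s=1..n. p ^ m s - x i / x s)) / ?c i)"
    if "m \<in> comps n (Suc N)" for m
  proof -
    have "(\<Prod>s=1..n. p ^ m s) = p ^ Suc N"
      using prod_power_mi_size[of p m n] that by (simp add: comps_def)
    then have "(\<Sum>i=1..n. (\<Prod>s=1..n. p ^ m s - x i / x s) / ?c i) = p ^ Suc N - 1"
      using L[of "\<lambda>s. p ^ m s" "\<lambda>s. 1 / x s"] x0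
      by (simp add: prod.distrib[symmetric])
    then have "(\<Sum>i=1..n. (\<Prod>s=1..n. p ^ m s - x i / x s) / ?c i) = - (1 - p ^ Suc N)"
      by simp
    moreover have "(\<Sum>i=1..n. - (milne_term n p x A b m * (\<Prod>s=1..n. p ^ m s - x i / x s)) / ?c i) =
        - (milne_term n p x A b m * (\<Sum>i=1..n. (\<Prod>s=1..n. p ^ m s - x i / x s) / ?c i))"
      by (simp add: sum_negf sum_distrib_left)
    ultimately show ?thesis
      by (simp only: mult_minus_left mult_minus_right minus_minus mult.commute)
  qed
  \<comment> \<open>Moving one node multiplies the product of the nodes by \<open>p\<close>, hence
    the exponent \<open>Suc j\<close>.\<close>
  have IH: "(\<Sum>m\<in>comps n N. milne_term n p (x(i := x i * p)) A b m) =
      (\<Prod>j<N. ?B - ?AX * p ^ Suc j) / qpoch p p N" if "i \<in> {1..n}" for i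
  proof -
    have "(\<Prod>s=1..n. (x(i := x i * p)) s) = (\<Prod>s=1..n. x s) * p"
      using that by (simp add: prod.remove[of _ i])
    then show ?thesis
      using Suc.IH[OF generic_shift[OF Suc.prems], of i] by (simp add: mult_ac fun_upd_def)
  qed
  have "(1 - p ^ Suc N) * (\<Sum>m\<in>comps n (Suc N). milne_term n p x A b m) =
      (\<Sum>i=1..n. \<Sum>m\<in>comps n (Suc N). - (milne_term n p x A b m * (\<Prod>s=1..n. p ^ m s - x i / x s)) / ?c i)"
    unfolding sum_distrib_left by (subst sum.swap) (rule sum.cong[OF refl w])
  also have "\<dots> = (\<Sum>i=1..n. \<Sum>m\<in>comps n N. (\<Prod>s=1..n. b s - A s * x i) / ?c i * milne_term n p (x(i := x i * p)) A b m)"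
  proof (rule sum.cong[OF refl])
    fix i assume i: "i \<in> {1..n}"
    \<comment> \<open>For \<open>m i = 0\<close> the factor \<open>s = i\<close> is
      \<open>p ^ 0 - x i / x i = 0\<close>, as \<open>sum_comps_shift\<close> requires.\<close>
    have "- (milne_term n p x A b m * (\<Prod>s=1..n. p ^ m s - x i / x s)) / ?c i = 0" if "m i = 0" for m
      using i that x0[OF i] by (simp add: prod.remove[of _ i])
    then show "(\<Sum>m\<in>comps n (Suc N). - (milne_term n p x A b m * (\<Prod>s=1..n. p ^ m s - x i / x s)) / ?c i) =
      (\<Sum>m\<in>comps n N. (\<Prod>s=1..n. b s - A s * x i) / ?c i * milne_term n p (x(i := x i * p)) A b m)"
      by (subst sum_comps_shift[OF i]) (simp_all only: milne_term_shift[OF Suc.prems i refl] minus_minus, simp)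
  qed
  also have "\<dots> = (\<Sum>i=1..n. (\<Prod>s=1..n. b s - A s * x i) / ?c i * ((\<Prod>j<N. ?B - ?AX * p ^ Suc j) / qpoch p p N))"
    unfolding sum_distrib_left[symmetric] using IH by (intro sum.cong) auto
  \<comment> \<open>The second interpolation, with the original \<open>b\<close> and
    \<open>A\<close>, supplies the missing factor \<open>j = 0\<close>.\<close>
  also have "\<dots> = (?B - ?AX) * ((\<Prod>j<N. ?B - ?AX * p ^ Suc j) / qpoch p p N)"
    unfolding sum_distrib_right[symmetric] L ..
  also have "\<dots> = (\<Prod>j<Suc N. ?B - ?AX * p ^ j) / qpoch p p N"
    by (subst prod.lessThan_Suc_shift) simp
  finally have "(\<Sum>m\<in>comps n (Suc N). milne_term n p x A b m) =
      (\<Prod>j<Suc N. ?B - ?AX * p ^ j) / qpoch p p N / (1 - p ^ Suc N)"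
    using p by (subst nonzero_eq_divide_eq) (simp_all add: mult.commute)
  then show ?case by (simp add: qpoch_Suc)
qed

section \<open>Reduction to one dimension\<close>

lemma prod_choose_two: "(\<Prod>j<k. p ^ j) = (p ^ (k choose 2) :: 'a::comm_semiring_1)"
  by (induction k) (simp_all add: numeral_2_eq_2 power_add mult_ac)

text \<open>The index \<open>s\<close> has \<open>s - 1\<close> predecessors, so the power of
  \<open>q\<^sup>2\<close> gives one factor \<open>(q\<^sup>2) ^ k s\<close> to each pair
  \<open>r < s\<close>. This clears the negative exponents.\<close>

lemma vandermonde_ratio_vdm:
  assumes "q \<noteq> 0" and x0: "\<forall>r\<in>{1..n}. x r \<noteq> 0"
  shows "vandermonde_ratio n q x k * (q\<^sup>2) ^ (\<Sum>r=1..n. (r - 1) * k r) =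
         vdm n (\<lambda>r. x r * (q\<^sup>2) ^ k r) / vdm n x"
proof -
  let ?p = "q\<^sup>2"
  have swap: "(\<Prod>r=1..n. \<Prod>s=r+1..n. f r s) = (\<Prod>s=1..n. \<Prod>r=1..<s. f r s)"
    for f :: "nat \<Rightarrow> nat \<Rightarrow> complex"
    unfolding prod.Sigma[OF finite_atLeastAtMost ballI[OF finite_atLeastAtMost]]
      prod.Sigma[OF finite_atLeastAtMost ballI[OF finite_atLeastLessThan]]
    by (rule prod.reindex_bij_witness[where i = "\<lambda>(a, b). (b, a)" and j = "\<lambda>(a, b). (b, a)"]) auto
  have pw: "?p ^ (\<Sum>r=1..n. (r - 1) * k r) = (\<Prod>s=1..n. \<Prod>r=1..<s. ?p ^ k s)"
    by (simp add: power_sum power_mult[symmetric] mult_ac)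
  have eq: "(1 - q powi (2 * int (k r) - 2 * int (k s)) * (x r / x s)) / (1 - x r / x s) * ?p ^ k s =
        (x r * ?p ^ k r - x s * ?p ^ k s) / (x r - x s)" if "s \<in> {1..n}" "r \<in> {1..<s}" for r s
  proof -
    have nz: "x r \<noteq> 0" "x s \<noteq> 0" "?p ^ k s \<noteq> 0" using that x0 assms(1) by auto
    define c where "c = - 1 / x s"
    have "q powi (2 * int (k r) - 2 * int (k s)) = ?p ^ k r / ?p ^ k s"
      using assms(1) by (simp add: power_int_diff power_int_mult)
    then have "(1 - q powi (2 * int (k r) - 2 * int (k s)) * (x r / x s)) * ?p ^ k s =
         c * (x r * ?p ^ k r - x s * ?p ^ k s)"
      using nz by (simp add: field_simps c_def)
    moreover have "1 - x r / x s = c * (x r - x s)"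
      using nz by (simp add: field_simps c_def)
    moreover have "c \<noteq> 0" using nz by (simp add: c_def)
    ultimately show ?thesis
      by (simp only: times_divide_eq_left mult_divide_mult_cancel_left not_False_eq_True)
  qed
  have V: "vandermonde_ratio n q x k = (\<Prod>s=1..n. \<Prod>r=1..<s.
        (1 - q powi (2 * int (k r) - 2 * int (k s)) * (x r / x s)) / (1 - x r / x s))"
    unfolding vandermonde_ratio_def by (rule swap)
  have "vdm n (\<lambda>r. x r * ?p ^ k r) / vdm n x =
      (\<Prod>s=1..n. \<Prod>r=1..<s. (x r * ?p ^ k r - x s * ?p ^ k s) / (x r - x s))"
    by (simp only: vdm_def prod_dividef)
  also have "\<dots> = (\<Prod>s=1..n. \<Prod>r=1..<s.
        (1 - q powi (2 * int (k r) - 2 * int (k s)) * (x r / x s)) / (1 - x r / x s) * ?p ^ k s)"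
    by (intro prod.cong refl eq[symmetric])
  finally show ?thesis
    by (simp only: V pw prod.distrib)
qed

section \<open>Evaluation of the inner sum\<close>

text \<open>The terminating basic hypergeometric series 3phi2 with upper parameters
  \<open>1 / p ^ K\<close>, \<open>a * p ^ K\<close>, \<open>a\<close>, lower parameters
  \<open>p\<close>, \<open>p\<close> and argument \<open>p\<close>.\<close>

definition inner_1d :: "complex \<Rightarrow> complex \<Rightarrow> nat \<Rightarrow> complex" where
  "inner_1d p a K = (\<Sum>M\<le>K. qpoch (1 / p ^ K) p M * qpoch (a * p ^ K) p M * qpoch a p M
     / qpoch p p M ^ 3 * p ^ M)"

lemma mi_size_mono: "(\<And>r. r \<in> {1..n} \<Longrightarrow> m r \<le> k r) \<Longrightarrow> mi_size n m \<le> mi_size n k"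
  unfolding mi_size_def by (rule sum_mono)

lemma inner_sum_eq_inner_1d:
  assumes g: "generic n (q\<^sup>2) x"
  shows "inner_sum n q x k = inner_1d (q\<^sup>2) q (mi_size n k)"
proof -
  let ?p = "q\<^sup>2" and ?K = "mi_size n k"
  let ?box = "\<Pi>\<^sub>E r\<in>{1..n}. {0..k r}"
  let ?A = "\<lambda>s. 1 / ?p ^ k s / x s"
  have q0: "q \<noteq> 0" and x0: "\<forall>r\<in>{1..n}. x r \<noteq> 0" using g by (auto simp: generic_def)
  define G where "G M = qpoch (q ^ (2 * ?K + 1)) ?p M * qpoch q ?p M / (qpoch ?p ?p M * qpoch ?p ?p M) * ?p ^ M" for M
  \<comment> \<open>Milne's summand with \<open>a s = 1 / ?p ^ k s\<close>; \<open>G\<close> holds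
    the part of the inner summand that sees only \<open>|m|\<close>.\<close>
  define F where "F m = milne_term n ?p x ?A (\<lambda>_. 1) m" for m
  have q2: "q powi (- 2 * int j) = 1 / ?p ^ j" for j
    using power_int_mult[of q 2 "- int j"] by (simp add: power_int_minus divide_simps)
  have num: "milne_num n ?p x ?A (\<lambda>_. 1) m =
      (\<Prod>r=1..n. \<Prod>s=1..n. qpoch (q powi (- 2 * int (k s)) * (x r / x s)) ?p (m r))" for m
    unfolding milne_num_def qpoch_def q2 by (intro prod.cong refl) simp
  \<comment> \<open>Of the weight \<open>r = (r - 1) + 1\<close> the first part completes the
    Vandermonde factor, the second goes into \<open>G\<close>.\<close>
  have pw: "q ^ (2 * (\<Sum>r=1..n. r * m r)) = ?p ^ (\<Sum>r=1..n. (r - 1) * m r) * ?p ^ mi_size n m" for m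
  proof -
    have "(\<Sum>r=1..n. r * m r) = (\<Sum>r=1..n. (r - 1) * m r) + mi_size n m"
      unfolding mi_size_def sum.distrib[symmetric] by (intro sum.cong) (auto simp: algebra_simps)
    then show ?thesis by (simp add: power_mult power_add)
  qed
  have F: "F m = vandermonde_ratio n q x m * ?p ^ (\<Sum>r=1..n. (r - 1) * m r) *
     (\<Prod>r=1..n. \<Prod>s=1..n. qpoch (q powi (- 2 * int (k s)) * (x r / x s)) (q\<^sup>2) (m r)
             / qpoch (q\<^sup>2 * (x r / x s)) (q\<^sup>2) (m r))" for m
    unfolding F_def milne_term_def vandermonde_ratio_vdm[OF q0 x0] num milne_den_def prod_dividef by simp
  have "inner_sum n q x k = (\<Sum>m\<in>?box. F m * G (mi_size n m))"
    unfolding inner_sum_def F G_def pw by (intro sum.cong refl) (simp only: mult_ac)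
  also have "\<dots> = (\<Sum>M\<le>?K. \<Sum>m\<in>{m \<in> ?box. mi_size n m = M}. F m * G (mi_size n m))"
  proof (rule sum.group[symmetric])
    show "finite ?box" by (intro finite_PiE) auto
    show "mi_size n ` ?box \<subseteq> {..?K}"
      by (auto intro!: mi_size_mono simp: PiE_def Pi_def)
  qed simp
  also have "\<dots> = (\<Sum>M\<le>?K. \<Sum>m\<in>comps n M. F m * G M)"
  proof (rule sum.cong[OF refl])
    fix M
    have "(\<Sum>m\<in>comps n M. F m * G M) = (\<Sum>m\<in>{m \<in> ?box. mi_size n m = M}. F m * G M)"
    proof (rule sum.mono_neutral_right[OF finite_comps])
      show "{m \<in> ?box. mi_size n m = M} \<subseteq> comps n M"
        by (auto simp: comps_def multi_indices_def PiE_def)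
      show "\<forall>m\<in>comps n M - {m \<in> ?box. mi_size n m = M}. F m * G M = 0"
      proof
        fix m assume m: "m \<in> comps n M - {m \<in> ?box. mi_size n m = M}"
        then have "\<not> (\<forall>r\<in>{1..n}. m r \<le> k r)"
          by (auto simp: comps_def multi_indices_def PiE_iff)
        then obtain r where r: "r \<in> {1..n}" "k r < m r" by force
        \<comment> \<open>Outside the box the factor with \<open>s = r\<close> and
          \<open>j = k r\<close> vanishes, so the box may be replaced by all compositions.\<close>
        have "(\<Prod>j<m r. 1 - ?A r * (x r * ?p ^ j)) = 0"
          using r x0 q0 by (auto intro!: bexI[of _ "k r"])
        then have "milne_num n ?p x ?A (\<lambda>_. 1) m = 0"
          unfolding milne_num_def using r by (meson finite_atLeastAtMost prod_zero)
        then show "F m * G M = 0" by (simp add: F_def milne_term_def)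
      qed
    qed
    then show "(\<Sum>m\<in>{m \<in> ?box. mi_size n m = M}. F m * G (mi_size n m)) = (\<Sum>m\<in>comps n M. F m * G M)"
      by simp
  qed
  also have "\<dots> = (\<Sum>M\<le>?K. qpoch (1 / ?p ^ ?K) ?p M / qpoch ?p ?p M * G M)"
  proof (rule sum.cong[OF refl])
    fix M
    have "(\<Prod>s=1..n. ?A s) * (\<Prod>s=1..n. x s) = (\<Prod>s=1..n. 1 / ?p ^ k s)"
      unfolding prod.distrib[symmetric] using x0 by (intro prod.cong) auto
    also have "\<dots> = 1 / ?p ^ ?K"
      unfolding prod_dividef prod_power_mi_size by simp
    finally have "(\<Sum>m\<in>comps n M. F m) = qpoch (1 / ?p ^ ?K) ?p M / qpoch ?p ?p M"
      unfolding F_def milne_fundamental[OF g] by (simp add: qpoch_def)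
    then show "(\<Sum>m\<in>comps n M. F m * G M) = qpoch (1 / ?p ^ ?K) ?p M / qpoch ?p ?p M * G M"
      by (simp add: sum_distrib_right[symmetric])
  qed
  also have "\<dots> = inner_1d ?p q ?K"
  proof -
    have e: "q ^ (2 * ?K + 1) = q * ?p ^ ?K" by (simp add: power_mult)
    show ?thesis unfolding inner_1d_def G_def e
      by (intro sum.cong refl) (simp add: power3_eq_cube mult.assoc)
  qed
  finally show ?thesis .
qed

section \<open>Evaluation of the outer sum at fixed size\<close>

text \<open>For \<open>p = q\<^sup>2\<close> and \<open>a = q\<close> this is the total of all outer
  terms of size \<open>K\<close>, without \<open>1 / w\<close>; the bracketed fraction comes from
  the confluent case of Milne's theorem.\<close>

definition alpha :: "complex \<Rightarrow> complex \<Rightarrow> nat \<Rightarrow> complex" where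
  "alpha p a K = (1 - a * p ^ (2 * K)) * qpoch a p K *
     ((-1) ^ K * p ^ (K choose 2) / qpoch p p K) * inner_1d p a K"

text \<open>Every factor is the monomial \<open>- (x r / x s) * p ^ j\<close>. Altogether
  \<open>x r\<close> occurs \<open>n * k r\<close> times in numerators and \<open>|k|\<close> times
  in denominators.\<close>

lemma milne_num_confluent:
  assumes x0: "\<forall>r\<in>{1..n}. x r \<noteq> 0"
  shows "milne_num n p x (\<lambda>s. 1 / x s) (\<lambda>_. 0) k =
         (-1) ^ (n * mi_size n k) * p ^ (n * (\<Sum>r=1..n. k r choose 2)) *
         (\<Prod>r=1..n. x r powi (int (n * k r) - int (mi_size n k)))"
proof -
  let ?K = "mi_size n k"
  have "milne_num n p x (\<lambda>s. 1 / x s) (\<lambda>_. 0) k =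
      (\<Prod>r=1..n. \<Prod>s=1..n. (-1) ^ k r * p ^ (k r choose 2) * (x r ^ k r * (1 / x s ^ k r)))"
  proof -
    have "(\<Prod>j<k r. 0 - 1 / x s * (x r * p ^ j)) = (-1) ^ k r * p ^ (k r choose 2) * (x r ^ k r * (1 / x s ^ k r))" for r s
    proof -
      have "(\<Prod>j<k r. 0 - 1 / x s * (x r * p ^ j)) = (\<Prod>j<k r. (-1) * (x r / x s) * p ^ j)" by simp
      then show ?thesis
        by (simp only: prod.distrib prod_constant card_lessThan prod_choose_two) (simp add: power_divide)
    qed
    then show ?thesis unfolding milne_num_def by (simp only:)
  qed
  also have "\<dots> = (\<Prod>r=1..n. \<Prod>s=1..n. (-1) ^ k r * p ^ (k r choose 2)) *
      ((\<Prod>r=1..n. \<Prod>s=1..n. x r ^ k r) * (\<Prod>r=1..n. \<Prod>s=1..n. 1 / x s ^ k r))"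
    unfolding prod.distrib ..
  also have "(\<Prod>r=1..n. \<Prod>s=1..n. (-1) ^ k r * p ^ (k r choose 2)) =
      (-1) ^ (n * ?K) * p ^ (n * (\<Sum>r=1..n. k r choose 2))"
    by (simp add: prod.distrib mi_size_def sum_distrib_left power_sum power_mult[symmetric] mult.commute power_mult_distrib)
  also have "(\<Prod>r=1..n. \<Prod>s=1..n. x r ^ k r) * (\<Prod>r=1..n. \<Prod>s=1..n. 1 / x s ^ k r) =
      (\<Prod>r=1..n. x r powi (int (n * k r) - int ?K))"
  proof -
    have "(\<Prod>r=1..n. \<Prod>s=1..n. 1 / x s ^ k r) = (\<Prod>s=1..n. 1 / x s ^ ?K)"
      by (subst prod.swap) (simp add: prod_dividef mi_size_def power_sum)
    moreover have "(\<Prod>r=1..n. \<Prod>s=1..n. x r ^ k r) = (\<Prod>r=1..n. x r ^ (n * k r))"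
      by (simp add: power_mult[symmetric] mult.commute)
    moreover have "(\<Prod>r=1..n. x r powi (int (n * k r) - int ?K)) = (\<Prod>r=1..n. x r ^ (n * k r) * (1 / x r ^ ?K))"
      using x0 by (intro prod.cong) (simp_all add: power_int_diff flip: of_nat_mult)
    ultimately show ?thesis by (simp only: prod.distrib)
  qed
  finally show ?thesis .
qed

text \<open>This isolates the confluent Milne summand; the bracket depends on \<open>k\<close> only
  through \<open>|k|\<close>.\<close>

lemma outer_term_eq:
  assumes g: "generic n (q\<^sup>2) x"
  shows "outer_term n w q x k = milne_term n (q\<^sup>2) x (\<lambda>s. 1 / x s) (\<lambda>_. 0) k *
     ((1 - q * (q\<^sup>2) ^ (2 * mi_size n k)) * qpoch q (q\<^sup>2) (mi_size n k) * inner_1d (q\<^sup>2) q (mi_size n k) / w)"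
proof -
  let ?p = "q\<^sup>2" and ?K = "mi_size n k"
  have q0: "q \<noteq> 0" and x0: "\<forall>r\<in>{1..n}. x r \<noteq> 0" using g by (auto simp: generic_def)
  have e1: "q ^ (2 * (\<Sum>r=1..n. (r - 1) * k r) + 2 * n * (\<Sum>r=1..n. k r choose 2)) =
     ?p ^ (\<Sum>r=1..n. (r - 1) * k r) * ?p ^ (n * (\<Sum>r=1..n. k r choose 2))"
    by (simp add: power_add power_mult)
  have e2: "q ^ (4 * ?K + 1) = q * ?p ^ (2 * ?K)"
    by (simp add: power_mult[symmetric])
  show ?thesis
    unfolding outer_term_def e1 e2 milne_term_def vandermonde_ratio_vdm[OF q0 x0, symmetric]
      milne_num_confluent[OF x0] milne_den_def inner_sum_eq_inner_1d[OF g]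
    by simp
qed

lemma sum_milne_confluent:
  assumes g: "generic n p x" and n: "n \<ge> 1"
  shows "(\<Sum>k\<in>comps n K. milne_term n p x (\<lambda>s. 1 / x s) (\<lambda>_. 0) k) =
         (-1) ^ K * p ^ (K choose 2) / qpoch p p K"
proof -
  have "(\<Prod>s=1..n. 1 / x s) * (\<Prod>s=1..n. x s) = 1"
    using g by (auto simp: generic_def prod.distrib[symmetric])
  \<comment> \<open>The place where \<open>n \<ge> 1\<close> enters: an empty product would be
    1.\<close>
  moreover have "(\<Prod>s=1..n. 0 :: complex) = 0" using n by simp
  moreover have "(\<Prod>j<K. 0 - 1 * p ^ j) = (\<Prod>j<K. (-1) * p ^ j)" by simp
  then have "(\<Prod>j<K. 0 - 1 * p ^ j) = (-1) ^ K * p ^ (K choose 2)"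
    by (simp only: prod.distrib prod_constant card_lessThan prod_choose_two)
  ultimately show ?thesis
    unfolding milne_fundamental[OF g] by (simp only:)
qed

lemma sum_outer_term:
  assumes "generic n (q\<^sup>2) x" "n \<ge> 1"
  shows "(\<Sum>k\<in>comps n K. outer_term n w q x k) = alpha (q\<^sup>2) q K / w"
proof -
  let ?p = "q\<^sup>2"
  have "(\<Sum>k\<in>comps n K. outer_term n w q x k) =
      (\<Sum>k\<in>comps n K. milne_term n ?p x (\<lambda>s. 1 / x s) (\<lambda>_. 0) k *
         ((1 - q * ?p ^ (2 * K)) * qpoch q ?p K * inner_1d ?p q K / w))"
    unfolding outer_term_eq[OF assms(1)] by (intro sum.cong) (auto simp: comps_def)
  also have "\<dots> = alpha ?p q K / w"
    unfolding sum_distrib_right[symmetric] sum_milne_confluent[OF assms] alpha_def by simp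
  finally show ?thesis .
qed

section \<open>The one-dimensional series\<close>

lemma power_ne_1:
  fixes p :: complex
  assumes "norm p < 1" "0 < j" shows "p ^ j \<noteq> 1"
  using assms by (metis norm_one norm_power norm_ge_zero not_less_iff_gr_or_eq power_less_one_iff)

lemma qpoch_self_nonzero: "norm p < 1 \<Longrightarrow> qpoch p p k \<noteq> 0"
  using power_ne_1[of p "Suc _"] by (auto simp: qpoch_eq_0_iff)

lemma qpoch_add: "qpoch a p (K + M) = qpoch a p K * qpoch (a * p ^ K) p M"
  by (induction M) (simp_all add: qpoch_Suc power_add mult_ac)

lemma abs_convergent_qpoch:
  fixes p :: complex
  assumes "norm p < 1"
  shows "abs_convergent_prod (\<lambda>i. 1 - z * p ^ i)"
proof (rule summable_imp_abs_convergent_prod)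
  have "summable (\<lambda>i. norm z * norm p ^ i)"
    using assms by (intro summable_mult summable_geometric) simp
  then show "summable (\<lambda>i. norm (1 - z * p ^ i - 1))"
    by (simp add: norm_mult norm_power)
qed

lemma qpoch_LIMSEQ: "norm p < 1 \<Longrightarrow> qpoch z p \<longlonglongrightarrow> qpoch_inf z p"
  using convergent_prod_LIMSEQ[OF abs_convergent_prod_imp_convergent_prod[OF abs_convergent_qpoch, of p z]]
  unfolding qpoch_inf_def qpoch_def[abs_def]
  \<comment> \<open>The library limit concerns products over \<open>i \<le> k\<close>, that is,
    \<open>qpoch z p (Suc k)\<close>.\<close>
  by (subst filterlim_sequentially_Suc[symmetric]) (simp add: lessThan_Suc_atMost)

lemma qpoch_inf_nonzero:
  assumes "norm p < 1" "\<And>k. qpoch z p k \<noteq> 0"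
  shows "qpoch_inf z p \<noteq> 0"
  unfolding qpoch_inf_def
proof (rule prodinf_nonzero)
  show "convergent_prod (\<lambda>i. 1 - z * p ^ i)"
    by (rule abs_convergent_prod_imp_convergent_prod[OF abs_convergent_qpoch[OF assms(1)]])
  show "1 - z * p ^ i \<noteq> 0" for i
    using assms(2)[of "Suc i"] by (simp add: qpoch_Suc)
qed

lemma bounded_of_LIMSEQ:
  fixes f :: "nat \<Rightarrow> complex"
  assumes "f \<longlonglongrightarrow> l" shows "\<exists>C>0. \<forall>n. norm (f n) \<le> C"
  using convergent_imp_Bseq[OF convergentI[OF assms]] by (auto simp: Bseq_def)

lemma qpoch_bounded:
  assumes "norm p < 1" shows "\<exists>C>0. \<forall>k. norm (qpoch z p k) \<le> C"
  by (rule bounded_of_LIMSEQ[OF qpoch_LIMSEQ[OF assms]])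

lemma inverse_qpoch_LIMSEQ:
  assumes "norm p < 1" "\<And>k. qpoch z p k \<noteq> 0"
  shows "(\<lambda>k. 1 / qpoch z p k) \<longlonglongrightarrow> 1 / qpoch_inf z p"
  by (rule tendsto_divide[OF tendsto_const qpoch_LIMSEQ[OF assms(1)] qpoch_inf_nonzero[OF assms]])

lemma inverse_qpoch_bounded:
  assumes "norm p < 1" "\<And>k. qpoch z p k \<noteq> 0"
  shows "\<exists>C>0. \<forall>k. norm (1 / qpoch z p k) \<le> C"
  by (rule bounded_of_LIMSEQ[OF inverse_qpoch_LIMSEQ[OF assms]])

section \<open>Euler's identity and a Tannery argument\<close>

lemma choose_two_Suc: "Suc k choose 2 = (k choose 2) + k"
  by (simp add: numeral_2_eq_2)

text \<open>The coefficient of \<open>z ^ L\<close> in the power series of the infinite product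
  \<open>qpoch_inf (p * z) p\<close>.\<close>

definition euler_coeff :: "complex \<Rightarrow> nat \<Rightarrow> complex" where
  "euler_coeff p L = (-1) ^ L * p ^ (Suc L choose 2) / qpoch p p L"

lemma euler_coeff_Suc:
  assumes "norm p < 1"
  shows "euler_coeff p (Suc L) * (1 - p ^ Suc L) = - (p ^ Suc L * euler_coeff p L)"
proof -
  have "1 - p ^ Suc L \<noteq> 0" using power_ne_1[OF assms, of "Suc L"] by simp
  then show ?thesis
    unfolding euler_coeff_def qpoch_Suc choose_two_Suc[of "Suc L"]
    by (simp add: power_add)
qed

text \<open>Compares coefficients in
  \<open>qpoch_inf (p * z) p / qpoch_inf z p = 1 / (1 - z)\<close>. The proof is finite: splitting
  \<open>1 - p ^ Suc N\<close> shows that \<open>(1 - p ^ Suc N) * ?S (Suc N)\<close> equals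
  \<open>(1 - p ^ Suc N) * ?S N\<close>.\<close>

lemma euler_convolution:
  assumes p: "norm p < 1"
  shows "(\<Sum>L\<le>N. euler_coeff p L / qpoch p p (N - L)) = 1"
proof (induction N)
  case 0
  then show ?case by (simp add: euler_coeff_def numeral_2_eq_2)
next
  case (Suc N)
  let ?E = "euler_coeff p" and ?S = "\<lambda>N. \<Sum>L\<le>N. euler_coeff p L / qpoch p p (N - L)"
  have split: "1 - p ^ Suc N = (1 - p ^ (Suc N - L)) + p ^ (Suc N - L) * (1 - p ^ L)" if "L \<le> Suc N" for L
    using that by (simp add: algebra_simps flip: power_add)
  have "(1 - p ^ Suc N) * ?S (Suc N) =
      (\<Sum>L\<le>Suc N. ?E L * (1 - p ^ (Suc N - L)) / qpoch p p (Suc N - L)) +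
      (\<Sum>L\<le>Suc N. ?E L * (1 - p ^ L) * p ^ (Suc N - L) / qpoch p p (Suc N - L))"
    unfolding sum_distrib_left sum.distrib[symmetric]
  proof (rule sum.cong[OF refl])
    fix L assume "L \<in> {..Suc N}"
    then have "L \<le> Suc N" by simp
    show "(1 - p ^ Suc N) * (?E L / qpoch p p (Suc N - L)) =
      ?E L * (1 - p ^ (Suc N - L)) / qpoch p p (Suc N - L) +
      ?E L * (1 - p ^ L) * p ^ (Suc N - L) / qpoch p p (Suc N - L)"
      unfolding split[OF \<open>L \<le> Suc N\<close>] by (simp add: add_divide_distrib[symmetric] algebra_simps)
  qed
  also have "(\<Sum>L\<le>Suc N. ?E L * (1 - p ^ (Suc N - L)) / qpoch p p (Suc N - L)) = ?S N"
  proof -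
    have "?E L * (1 - p ^ (Suc N - L)) / qpoch p p (Suc N - L) = ?E L / qpoch p p (N - L)" if "L \<le> N" for L
      using that power_ne_1[OF p, of "Suc (N - L)"] by (simp add: Suc_diff_le qpoch_Suc)
    then show ?thesis by simp
  qed
  also have "(\<Sum>L\<le>Suc N. ?E L * (1 - p ^ L) * p ^ (Suc N - L) / qpoch p p (Suc N - L)) = - (p ^ Suc N) * ?S N"
  proof -
    have shift: "?E (Suc L) * (1 - p ^ Suc L) * p ^ (N - L) = - (p ^ Suc N) * ?E L" if "L \<le> N" for L
    proof -
      have "Suc N = Suc L + (N - L)" using that by simp
      then have "p ^ Suc N = p ^ Suc L * p ^ (N - L)" by (metis power_add)
      then show ?thesis unfolding euler_coeff_Suc[OF p] by (simp only: mult_minus_left mult_minus_right mult_ac)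
    qed
    have "(\<Sum>L\<le>Suc N. ?E L * (1 - p ^ L) * p ^ (Suc N - L) / qpoch p p (Suc N - L)) =
        (\<Sum>L\<le>N. ?E (Suc L) * (1 - p ^ Suc L) * p ^ (N - L) / qpoch p p (N - L))"
      by (subst sum.atMost_Suc_shift) simp
    also have "\<dots> = (\<Sum>L\<le>N. - (p ^ Suc N) * (?E L / qpoch p p (N - L)))"
      by (intro sum.cong refl) (simp only: atMost_iff shift times_divide_eq_right)
    finally show ?thesis by (simp only: sum_distrib_left)
  qed
  finally have "(1 - p ^ Suc N) * ?S (Suc N) = (1 - p ^ Suc N) * 1"
    using Suc.IH by simp
  then show ?case using power_ne_1[OF p, of "Suc N"] by (metis mult_cancel_left right_minus_eq zero_less_Suc)
qed

lemma choose_two_Suc_ge: "k \<le> Suc k choose 2"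
  by (simp add: choose_two_Suc)

lemma euler_coeff_bound:
  assumes "norm p < 1"
  shows "\<exists>C>0. \<forall>L. norm (euler_coeff p L) \<le> C * norm p ^ (Suc L choose 2)"
proof -
  obtain C where "C > 0" "\<And>k. norm (1 / qpoch p p k) \<le> C"
    using inverse_qpoch_bounded[OF assms qpoch_self_nonzero[OF assms]] by blast
  moreover have "norm (euler_coeff p L) = norm (1 / qpoch p p L) * norm p ^ (Suc L choose 2)" for L
    by (simp add: euler_coeff_def norm_mult norm_divide norm_power)
  ultimately show ?thesis by (auto intro!: exI[of _ C] mult_right_mono)
qed

lemma euler_tannery:
  assumes p: "norm p < 1"
    and lim: "\<And>L. (\<lambda>N. u N L) \<longlonglongrightarrow> l"
    and bd: "\<And>N L. L \<le> N \<Longrightarrow> norm (u N L) \<le> D"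
  shows "(\<lambda>N. \<Sum>L\<le>N. euler_coeff p L * u N L) \<longlonglongrightarrow> (\<Sum>L. euler_coeff p L) * l"
proof -
  obtain C where C: "C > 0" "\<And>L. norm (euler_coeff p L) \<le> C * norm p ^ (Suc L choose 2)"
    using euler_coeff_bound[OF p] by blast
  have E: "norm (euler_coeff p L) \<le> C * norm p ^ L" for L
  proof -
    have "norm p ^ (Suc L choose 2) \<le> norm p ^ L"
      using p by (intro power_decreasing choose_two_Suc_ge) auto
    then show ?thesis using C(1) C(2)[of L] by (meson mult_left_mono less_imp_le order_trans)
  qed
  have sm: "summable (\<lambda>L. C * norm p ^ L)"
    using p by (intro summable_mult summable_geometric) simp
  then have sE: "summable (\<lambda>L. norm (euler_coeff p L))"
    by (rule summable_comparison_test'[where N = 0]) (use E in auto)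
  have D0: "D \<ge> 0" using bd[of 0 0] norm_ge_zero order_trans by blast
  \<comment> \<open>Extension by zero turns the finite sums into series, and the bound on
    \<open>u\<close> is available only for \<open>L \<le> N\<close>.\<close>
  let ?a = "\<lambda>L N. if L \<le> N then euler_coeff p L * u N L else 0"
  have "(\<lambda>N. suminf (\<lambda>L. ?a L N)) \<longlonglongrightarrow> suminf (\<lambda>L. euler_coeff p L * l)"
  proof (rule tannerys_theorem[THEN conjunct2, THEN conjunct2])
    show "summable (\<lambda>L. C * norm p ^ L * D)" by (rule summable_mult2[OF sm])
    show "(\<lambda>N. ?a L N) \<longlonglongrightarrow> euler_coeff p L * l" for L
    proof (rule Lim_transform_eventually)
      show "(\<lambda>N. euler_coeff p L * u N L) \<longlonglongrightarrow> euler_coeff p L * l"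
        by (intro tendsto_intros lim)
      show "\<forall>\<^sub>F N in sequentially. euler_coeff p L * u N L = ?a L N"
        using eventually_ge_at_top[of L] by eventually_elim simp
    qed
    have "norm (?a L N) \<le> C * norm p ^ L * D" for L N
      using E[of L] bd[of L N] C(1) D0 by (auto simp: norm_mult intro!: mult_mono)
    then show "\<forall>\<^sub>F (L, N) in sequentially \<times>\<^sub>F sequentially. norm (?a L N) \<le> C * norm p ^ L * D"
      by (intro always_eventually) auto
  qed simp
  moreover have "suminf (\<lambda>L. ?a L N) = (\<Sum>L\<le>N. euler_coeff p L * u N L)" for N
    by (subst suminf_finite[of "{..N}"]) auto
  moreover have "suminf (\<lambda>L. euler_coeff p L * l) = suminf (euler_coeff p) * l"
    using suminf_mult2[OF summable_norm_cancel[OF sE], of l] by simp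
  ultimately show ?thesis
    by simp
qed

lemma LIMSEQ_diff_const: "f \<longlonglongrightarrow> l \<Longrightarrow> (\<lambda>n. f (n - k)) \<longlonglongrightarrow> l"
  by (rule LIMSEQ_offset[of _ k]) simp

text \<open>The limit of \<open>euler_convolution\<close>: the constant 1 is also the sum of the
  series divided by \<open>qpoch_inf p p\<close>.\<close>

lemma suminf_euler_coeff:
  assumes p: "norm p < 1"
  shows "(\<Sum>L. euler_coeff p L) = qpoch_inf p p"
proof -
  have nz: "qpoch_inf p p \<noteq> 0" by (intro qpoch_inf_nonzero qpoch_self_nonzero p)
  obtain D where D: "\<And>k. norm (1 / qpoch p p k) \<le> D"
    using inverse_qpoch_bounded[OF p qpoch_self_nonzero[OF p]] by blast
  have "(\<lambda>N. \<Sum>L\<le>N. euler_coeff p L * (1 / qpoch p p (N - L))) \<longlonglongrightarrow> (\<Sum>L. euler_coeff p L) * (1 / qpoch_inf p p)"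
    by (rule euler_tannery[OF p _ D])
       (rule LIMSEQ_diff_const[OF inverse_qpoch_LIMSEQ[OF p qpoch_self_nonzero[OF p]]])
  moreover have "(\<lambda>N. \<Sum>L\<le>N. euler_coeff p L * (1 / qpoch p p (N - L))) = (\<lambda>_. 1)"
    using euler_convolution[OF p] by simp
  ultimately have "(\<Sum>L. euler_coeff p L) * (1 / qpoch_inf p p) = 1"
    by (metis LIMSEQ_unique tendsto_const)
  then show ?thesis using nz by (simp add: field_simps)
qed

section \<open>Bailey inversion and the value of the series\<close>

text \<open>Up to the factor \<open>1 - a\<close>, \<open>alpha\<close> and \<open>beta\<close> form
  a Bailey pair relative to \<open>a\<close>; \<open>alpha_expand\<close> is the inversion
  formula.\<close>

definition beta :: "complex \<Rightarrow> complex \<Rightarrow> nat \<Rightarrow> complex" where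
  "beta p a M = qpoch a p M / qpoch p p M ^ 3"

text \<open>Reversal of the product \<open>qpoch (1 / p ^ N) p M\<close> for
  \<open>N = M + L\<close>. This form avoids subtraction and allows induction on \<open>M\<close>
  with \<open>L\<close> fixed.\<close>

lemma qpoch_negative_power:
  assumes p: "norm p < 1" "p \<noteq> 0"
  shows "(-1) ^ (M + L) * p ^ ((M + L) choose 2) / qpoch p p (M + L) * qpoch (1 / p ^ (M + L)) p M * p ^ M =
         (-1) ^ L * p ^ (L choose 2) / qpoch p p L"
proof (induction M)
  case (Suc M)
  let ?N = "M + L"
  have n1: "p ^ Suc ?N \<noteq> 1" by (intro power_ne_1 p) simp
  have e: "1 / p ^ Suc ?N * p = 1 / p ^ ?N" using p by simp
  have k: "- (p ^ ?N * p * (1 - 1 / p ^ Suc ?N)) / (1 - p * p ^ ?N) = 1"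
    using p n1 by (simp add: field_simps)
  have "(-1) ^ (Suc M + L) * p ^ ((Suc M + L) choose 2) / qpoch p p (Suc M + L) * qpoch (1 / p ^ (Suc M + L)) p (Suc M) * p ^ Suc M
     = ((-1) ^ ?N * p ^ (?N choose 2) / qpoch p p ?N * qpoch (1 / p ^ ?N) p M * p ^ M) *
       (- (p ^ ?N * p * (1 - 1 / p ^ Suc ?N)) / (1 - p * p ^ ?N))"
    unfolding add_Suc choose_two_Suc qpoch_Suc_shift[of _ _ M] e qpoch_Suc[of p p ?N] power_add[of p "?N choose 2" ?N]
    by (simp add: mult_ac)
  then show ?case unfolding k Suc.IH by simp
qed simp

lemma alpha_expand:
  assumes p: "norm p < 1" "p \<noteq> 0"
  shows "alpha p a K = (\<Sum>M\<le>K. (1 - a * p ^ (2 * K)) * qpoch a p (K + M) *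
     ((-1) ^ (K - M) * p ^ ((K - M) choose 2) / qpoch p p (K - M)) * beta p a M)"
  unfolding alpha_def inner_1d_def sum_distrib_left
proof (rule sum.cong[OF refl])
  fix M assume "M \<in> {..K}"
  then obtain L where K: "K = M + L" by (metis atMost_iff le_iff_add)
  have KM: "K - M = L" using K by simp
  show "(1 - a * p ^ (2 * K)) * qpoch a p K * ((-1) ^ K * p ^ (K choose 2) / qpoch p p K) *
     (qpoch (1 / p ^ K) p M * qpoch (a * p ^ K) p M * qpoch a p M / qpoch p p M ^ 3 * p ^ M) =
     (1 - a * p ^ (2 * K)) * qpoch a p (K + M) *
     ((-1) ^ (K - M) * p ^ ((K - M) choose 2) / qpoch p p (K - M)) * beta p a M"
    unfolding KM qpoch_negative_power[OF p, of M L, symmetric] K[symmetric] qpoch_add beta_def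
    by simp
qed

text \<open>For fixed \<open>M\<close> the sum over \<open>K\<close> of the terms in \<open>alpha_expand\<close> telescopes.\<close>

lemma sum_alpha:
  assumes p: "norm p < 1" "p \<noteq> 0"
  shows "(\<Sum>K\<le>N. alpha p a K) = (\<Sum>M\<le>N. euler_coeff p (N - M) * qpoch a p (Suc (N + M)) * beta p a M)"
proof (induction N)
  case 0
  then show ?case
    by (simp add: alpha_expand[OF p] euler_coeff_def beta_def qpoch_def numeral_2_eq_2)
next
  case (Suc N)
  let ?t = "\<lambda>K M. (1 - a * p ^ (2 * K)) * qpoch a p (K + M) *
     ((-1) ^ (K - M) * p ^ ((K - M) choose 2) / qpoch p p (K - M)) * beta p a M"
  let ?T = "\<lambda>N M. euler_coeff p (N - M) * qpoch a p (Suc (N + M)) * beta p a M"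
  have "?T N M + ?t (Suc N) M = ?T (Suc N) M" if le: "M \<le> N" for M
  proof -
    obtain L where N: "N = M + L" using le_Suc_ex[OF le] by blast
    have d: "N - M = L" "Suc N - M = Suc L" using N by simp_all
    have n1: "1 - p ^ Suc L \<noteq> 0" using power_ne_1[OF p(1), of "Suc L"] by simp
    \<comment> \<open>In these names the step is
      \<open>c * (1 - r) - c * (1 - z * r) = - (c * r) * (1 - z)\<close>, up to common
      factors.\<close>
    define c where "c = (-1) ^ L * p ^ (Suc L choose 2) / qpoch p p L / (1 - p ^ Suc L)"
    define r where "r = p ^ Suc L"
    define z where "z = a * p ^ (Suc (N + M))"
    have cr: "c * (1 - r) = euler_coeff p L"
      using n1 by (simp add: c_def r_def euler_coeff_def)
    have 1: "euler_coeff p (Suc L) = - (c * r)"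
      unfolding euler_coeff_def qpoch_Suc choose_two_Suc[of "Suc L"] c_def r_def by (simp add: power_add)
    have 2: "(-1) ^ Suc L * p ^ (Suc L choose 2) / qpoch p p (Suc L) = - c"
      unfolding qpoch_Suc c_def by simp
    have 3: "a * p ^ (2 * Suc N) = z * r"
    proof -
      have "2 * Suc N = Suc (N + M) + Suc L" using N by simp
      then show ?thesis unfolding z_def r_def by (metis mult.assoc power_add)
    qed
    have 4: "qpoch a p (Suc (Suc N + M)) = qpoch a p (Suc (N + M)) * (1 - z)"
      unfolding z_def by (subst qpoch_Suc) simp
    have 5: "qpoch a p (Suc N + M) = qpoch a p (Suc (N + M))" by simp
    show ?thesis
      unfolding d 1 2 3 4 5 cr[symmetric] by algebra
  qed
  \<comment> \<open>The index \<open>M = Suc N\<close> is new, so here there is no earlier partial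
    sum to add.\<close>
  moreover have "?t (Suc N) (Suc N) = ?T (Suc N) (Suc N)"
    by (simp add: qpoch_Suc[of a p "Suc _"] euler_coeff_def numeral_2_eq_2 mult_2 mult_ac)
  ultimately show ?case
    using Suc.IH by (simp only: sum.atMost_Suc alpha_expand[OF p] add.assoc[symmetric] sum.distrib[symmetric])
       (simp add: sum.distrib[symmetric])
qed

text \<open>Reversing the order attaches a fixed Euler coefficient to each index, the form that
  \<open>euler_tannery\<close> expects.\<close>

lemma sum_alpha_rev:
  assumes p: "norm p < 1" "p \<noteq> 0"
  shows "(\<Sum>K\<le>N. alpha p a K) = (\<Sum>L\<le>N. euler_coeff p L * (qpoch a p (Suc (2 * N - L)) * beta p a (N - L)))"
  unfolding sum_alpha[OF p]
proof (rule sum.reindex_bij_witness[where i = "\<lambda>L. N - L" and j = "\<lambda>M. N - M"])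
  fix M assume "M \<in> {..N}"
  then have "2 * N - (N - M) = N + M" "N - (N - M) = M" by auto
  then show "euler_coeff p (N - M) * (qpoch a p (Suc (2 * N - (N - M))) * beta p a (N - (N - M))) =
      euler_coeff p (N - M) * qpoch a p (Suc (N + M)) * beta p a M"
    by (simp only: mult.assoc)
qed auto

lemma beta_LIMSEQ:
  assumes "norm p < 1"
  shows "beta p a \<longlonglongrightarrow> qpoch_inf a p / qpoch_inf p p ^ 3"
proof -
  have "qpoch_inf p p ^ 3 \<noteq> 0" by (simp add: qpoch_inf_nonzero qpoch_self_nonzero assms)
  then show ?thesis
    unfolding beta_def[abs_def]
    by (rule tendsto_divide[OF qpoch_LIMSEQ[OF assms] tendsto_power[OF qpoch_LIMSEQ[OF assms]]])
qed

text \<open>For fixed \<open>L\<close> both \<open>2 * N - L\<close> and \<open>N - L\<close> tend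
  to infinity, so the cofactor of the Euler coefficient has a limit independent of \<open>L\<close>;
  Euler's identity then removes one of the three powers of \<open>qpoch_inf p p\<close>.\<close>

lemma sums_alpha:
  assumes p: "norm p < 1" "p \<noteq> 0"
  shows "alpha p a sums (qpoch_inf a p ^ 2 / qpoch_inf p p ^ 2)"
proof -
  have nz: "qpoch_inf p p \<noteq> 0" by (intro qpoch_inf_nonzero qpoch_self_nonzero p)
  obtain C1 where C1: "C1 > 0" "\<And>k. norm (qpoch a p k) \<le> C1" using qpoch_bounded[OF p(1)] by blast
  obtain C2 where C2: "C2 > 0" "\<And>k. norm (beta p a k) \<le> C2"
    using bounded_of_LIMSEQ[OF beta_LIMSEQ[OF p(1)]] by blast
  have "(\<lambda>N. \<Sum>L\<le>N. euler_coeff p L * (qpoch a p (Suc (2 * N - L)) * beta p a (N - L)))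
     \<longlonglongrightarrow> (\<Sum>L. euler_coeff p L) * (qpoch_inf a p * (qpoch_inf a p / qpoch_inf p p ^ 3))"
  proof (rule euler_tannery[OF p(1)])
    fix L
    have "filterlim (\<lambda>N. Suc (2 * N - L)) at_top sequentially"
      by (rule filterlim_at_top_mono[OF filterlim_minus_const_nat_at_top[of L]]) (auto intro: always_eventually)
    then show "(\<lambda>N. qpoch a p (Suc (2 * N - L)) * beta p a (N - L)) \<longlonglongrightarrow>
       qpoch_inf a p * (qpoch_inf a p / qpoch_inf p p ^ 3)"
      by (intro tendsto_mult LIMSEQ_diff_const beta_LIMSEQ p filterlim_compose[OF qpoch_LIMSEQ[OF p(1)]])
  next
    fix N L
    show "norm (qpoch a p (Suc (2 * N - L)) * beta p a (N - L)) \<le> C1 * C2"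
      unfolding norm_mult using C1 C2 by (intro mult_mono) (auto intro: less_imp_le)
  qed
  moreover have "(\<Sum>L. euler_coeff p L) * (qpoch_inf a p * (qpoch_inf a p / qpoch_inf p p ^ 3)) =
     qpoch_inf a p ^ 2 / qpoch_inf p p ^ 2"
    using nz by (simp add: suminf_euler_coeff[OF p(1)] power2_eq_square power3_eq_cube)
  ultimately show ?thesis
    unfolding sums_def_le sum_alpha_rev[OF p] by simp
qed

section \<open>Geometric decay of the one-dimensional terms\<close>

text \<open>Convergence with a rate when \<open>c < 1\<close>: \<open>alpha\<close> is a difference
  of partial sums, so differences have to be controlled. One constant for both bounds keeps the
  closure under products short.\<close>

definition geom_cauchy :: "real \<Rightarrow> (nat \<Rightarrow> complex) \<Rightarrow> bool" where
  "geom_cauchy c f \<longleftrightarrow> (\<exists>C. \<forall>n. norm (f n) \<le> C \<and> norm (f (Suc n) - f n) \<le> C * c ^ n)"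

lemma geom_cauchy_mult:
  assumes "geom_cauchy c f" "geom_cauchy c g" "c \<ge> 0"
  shows "geom_cauchy c (\<lambda>n. f n * g n)"
proof -
  obtain C where C: "\<And>n. norm (f n) \<le> C" "\<And>n. norm (f (Suc n) - f n) \<le> C * c ^ n"
    using assms(1) by (auto simp: geom_cauchy_def)
  obtain D where D: "\<And>n. norm (g n) \<le> D" "\<And>n. norm (g (Suc n) - g n) \<le> D * c ^ n"
    using assms(2) by (auto simp: geom_cauchy_def)
  have nn: "C \<ge> 0" "D \<ge> 0" using C(1)[of 0] D(1)[of 0] norm_ge_zero order_trans by blast+
  show ?thesis
    unfolding geom_cauchy_def
  proof (intro exI[of _ "2 * C * D"] allI conjI)
    fix n
    have "norm (f n * g n) \<le> C * D"
      unfolding norm_mult using C D nn by (intro mult_mono) auto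
    then show "norm (f n * g n) \<le> 2 * C * D" using nn mult_nonneg_nonneg[OF nn] by linarith
    have "f (Suc n) * g (Suc n) - f n * g n = f (Suc n) * (g (Suc n) - g n) + (f (Suc n) - f n) * g n"
      by (simp add: algebra_simps)
    then have "norm (f (Suc n) * g (Suc n) - f n * g n) \<le>
        norm (f (Suc n)) * norm (g (Suc n) - g n) + norm (f (Suc n) - f n) * norm (g n)"
      by (metis norm_mult norm_triangle_ineq)
    also have "\<dots> \<le> C * (D * c ^ n) + (C * c ^ n) * D"
      using C D nn assms(3) by (intro add_mono mult_mono) auto
    finally show "norm (f (Suc n) * g (Suc n) - f n * g n) \<le> 2 * C * D * c ^ n" by (simp add: algebra_simps)
  qed
qed

lemma geom_cauchy_qpoch:
  assumes "norm p < 1" shows "geom_cauchy (norm p) (qpoch z p)"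
proof -
  obtain C where C: "C > 0" "\<And>k. norm (qpoch z p k) \<le> C" using qpoch_bounded[OF assms] by blast
  show ?thesis
    unfolding geom_cauchy_def
  proof (intro exI[of _ "C * (1 + norm z)"] allI conjI)
    fix n
    have "C \<le> C * (1 + norm z)" using C(1) by simp
    then show "norm (qpoch z p n) \<le> C * (1 + norm z)" using C(2)[of n] by linarith
    have "norm (qpoch z p (Suc n) - qpoch z p n) = norm (qpoch z p n) * norm z * norm p ^ n"
      by (simp add: qpoch_Suc algebra_simps norm_mult norm_power)
    also have "\<dots> \<le> C * (1 + norm z) * norm p ^ n"
      using C by (intro mult_right_mono mult_mono) (auto intro: less_imp_le)
    finally show "norm (qpoch z p (Suc n) - qpoch z p n) \<le> C * (1 + norm z) * norm p ^ n" .
  qed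
qed

lemma geom_cauchy_inverse_qpoch:
  assumes "norm p < 1" shows "geom_cauchy (norm p) (\<lambda>k. 1 / qpoch p p k)"
proof -
  obtain C where C: "C > 0" "\<And>k. norm (1 / qpoch p p k) \<le> C"
    using inverse_qpoch_bounded[OF assms qpoch_self_nonzero[OF assms]] by blast
  show ?thesis
    unfolding geom_cauchy_def
  proof (intro exI[of _ C] allI conjI)
    fix n
    show "norm (1 / qpoch p p n) \<le> C" by (rule C)
    have "1 - p ^ Suc n \<noteq> 0" using power_ne_1[OF assms, of "Suc n"] by simp
    then have "1 / qpoch p p (Suc n) - 1 / qpoch p p n = 1 / qpoch p p (Suc n) * p ^ Suc n"
      using qpoch_self_nonzero[OF assms, of n] by (simp add: qpoch_Suc field_simps)
    then have "norm (1 / qpoch p p (Suc n) - 1 / qpoch p p n) = norm (1 / qpoch p p (Suc n)) * norm p ^ Suc n"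
      by (simp only: norm_mult norm_power)
    also have "\<dots> \<le> C * norm p ^ n"
      using C assms by (intro mult_mono C power_decreasing) (auto intro: less_imp_le)
    finally show "norm (1 / qpoch p p (Suc n) - 1 / qpoch p p n) \<le> C * norm p ^ n" .
  qed
qed

lemma geom_cauchy_beta:
  assumes "norm p < 1" shows "geom_cauchy (norm p) (beta p a)"
proof -
  have eq: "beta p a = (\<lambda>M. qpoch a p M * (1 / qpoch p p M * (1 / qpoch p p M * (1 / qpoch p p M))))"
    by (simp add: fun_eq_iff beta_def power3_eq_cube)
  show ?thesis
    unfolding eq by (intro geom_cauchy_mult geom_cauchy_qpoch geom_cauchy_inverse_qpoch assms norm_ge_zero)
qed

text \<open>In the difference of consecutive partial sums, the cofactor with index \<open>L\<close>
  changes by a multiple of \<open>norm p ^ (N - L)\<close>. The Euler coefficient contributes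
  \<open>norm p ^ (L + (L choose 2))\<close>, which restores the exponent \<open>N\<close> and
  leaves a factor summable over \<open>L\<close>.\<close>

lemma alpha_bound:
  assumes p: "norm p < 1" "p \<noteq> 0"
  shows "\<exists>C. \<forall>K. norm (alpha p a K) \<le> C * norm p ^ K"
proof -
  let ?c = "norm p" and ?g = "qpoch a p" and ?b = "beta p a" and ?E = "euler_coeff p"
  have c: "0 < ?c" "?c < 1" using p by auto
  obtain G where G: "\<And>n. norm (?g n) \<le> G" "\<And>n. norm (?g (Suc n) - ?g n) \<le> G * ?c ^ n"
    using geom_cauchy_qpoch[OF p(1), of a] by (auto simp: geom_cauchy_def)
  obtain B where B: "\<And>n. norm (?b n) \<le> B" "\<And>n. norm (?b (Suc n) - ?b n) \<le> B * ?c ^ n"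
    using geom_cauchy_beta[OF p(1), of a] by (auto simp: geom_cauchy_def)
  obtain C where C: "C > 0" "\<And>L. norm (?E L) \<le> C * ?c ^ (Suc L choose 2)"
    using euler_coeff_bound[OF p(1)] by blast
  have nn: "G \<ge> 0" "B \<ge> 0" using G(1)[of 0] B(1)[of 0] norm_ge_zero order_trans by blast+
  let ?v = "\<lambda>N L. ?g (Suc (2 * N - L)) * ?b (N - L)"
  \<comment> \<open>The first index moves by two and the second by one: three elementary
    differences, hence the 3.\<close>
  have v: "norm (?v (Suc N) L - ?v N L) \<le> 3 * G * B * ?c ^ (N - L)" if "L \<le> N" for N L
  proof -
    define M j where "M = N - L" and "j = Suc (2 * N - L)"
    have j: "Suc (2 * Suc N - L) = Suc (Suc j)" "Suc N - L = Suc M" "M \<le> j" "M \<le> Suc j"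
      using that by (auto simp: M_def j_def)
    have "?g (Suc (Suc j)) * ?b (Suc M) - ?g j * ?b M =
       ?g (Suc (Suc j)) * (?b (Suc M) - ?b M) + ((?g (Suc (Suc j)) - ?g (Suc j)) + (?g (Suc j) - ?g j)) * ?b M"
      by (simp add: algebra_simps)
    also have "norm \<dots> \<le> norm (?g (Suc (Suc j))) * norm (?b (Suc M) - ?b M) +
       (norm (?g (Suc (Suc j)) - ?g (Suc j)) + norm (?g (Suc j) - ?g j)) * norm (?b M)"
      by (rule order_trans[OF norm_triangle_ineq])
         (simp only: norm_mult, intro add_mono mult_right_mono norm_triangle_ineq order_refl norm_ge_zero)
    also have "\<dots> \<le> G * (B * ?c ^ M) + (G * ?c ^ M + G * ?c ^ M) * B"
    proof -
      have "G * ?c ^ Suc j \<le> G * ?c ^ M" "G * ?c ^ j \<le> G * ?c ^ M"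
        using c nn j by (intro mult_left_mono power_decreasing; simp)+
      then have "norm (?g (Suc (Suc j)) - ?g (Suc j)) \<le> G * ?c ^ M" "norm (?g (Suc j) - ?g j) \<le> G * ?c ^ M"
        using G(2)[of j] G(2)[of "Suc j"] by linarith+
      then show ?thesis using G(1) B nn c by (intro add_mono mult_mono) auto
    qed
    finally show ?thesis
      unfolding j M_def[symmetric] j_def[symmetric] by (simp add: algebra_simps)
  qed
  have ch: "L \<le> Suc (L choose 2)" for L
    using choose_two_Suc_ge[of "L - 1"] by (cases L) auto
  have sm: "(\<Sum>L\<le>N. ?c ^ (L choose 2)) \<le> 1 / (?c * (1 - ?c))" for N
  proof -
    \<comment> \<open>From \<open>L - 1 \<le> L choose 2\<close>, which reduces the sum to a
      geometric series.\<close>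
    have "?c ^ (L choose 2) \<le> ?c ^ L / ?c" for L
      using power_decreasing[OF ch[of L], of ?c] c by (simp add: field_simps)
    then have "(\<Sum>L\<le>N. ?c ^ (L choose 2)) \<le> (\<Sum>L\<le>N. ?c ^ L / ?c)" by (intro sum_mono)
    also have "\<dots> = (\<Sum>L\<le>N. ?c ^ L) / ?c" by (simp add: sum_divide_distrib)
    also have "\<dots> \<le> (1 / (1 - ?c)) / ?c"
      using c by (intro divide_right_mono) (auto simp: sum_gp0 divide_simps)
    finally show ?thesis by (simp add: mult.commute)
  qed
  define D where "D = C * (3 * G * B) * (1 / (?c * (1 - ?c))) + C * (G * B)"
  have main: "norm (alpha p a (Suc N)) \<le> D * ?c ^ N" for N
  proof -
    have "alpha p a (Suc N) = (\<Sum>K\<le>Suc N. alpha p a K) - (\<Sum>K\<le>N. alpha p a K)" by simp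
    \<comment> \<open>The summand \<open>L = Suc N\<close> has no partner in the shorter sum and is
      estimated separately.\<close>
    then have e: "alpha p a (Suc N) = (\<Sum>L\<le>N. ?E L * (?v (Suc N) L - ?v N L)) + ?E (Suc N) * ?v (Suc N) (Suc N)"
      unfolding sum_alpha_rev[OF p]
      unfolding sum.atMost_Suc[of _ N] right_diff_distrib sum_subtractf by simp
    have "norm (alpha p a (Suc N)) \<le> (\<Sum>L\<le>N. norm (?E L) * norm (?v (Suc N) L - ?v N L)) + norm (?E (Suc N)) * norm (?v (Suc N) (Suc N))"
      unfolding e
      by (rule order_trans[OF norm_triangle_ineq], rule add_mono, rule order_trans[OF norm_sum])
         (simp_all only: norm_mult order_refl)
    also have "\<dots> \<le> (\<Sum>L\<le>N. C * (3 * G * B) * ?c ^ N * ?c ^ (L choose 2)) + C * ?c ^ N * (G * B)"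
    proof (rule add_mono, rule sum_mono)
      fix L assume "L \<in> {..N}"
      then have L: "L \<le> N" by simp
      have "norm (?E L) * norm (?v (Suc N) L - ?v N L) \<le> (C * ?c ^ (Suc L choose 2)) * (3 * G * B * ?c ^ (N - L))"
        using C c v[OF L] by (intro mult_mono) auto
      also have "\<dots> = C * (3 * G * B) * (?c ^ (L + (N - L)) * ?c ^ (L choose 2))"
        unfolding choose_two_Suc power_add by (simp only: mult_ac)
      finally show "norm (?E L) * norm (?v (Suc N) L - ?v N L) \<le> C * (3 * G * B) * ?c ^ N * ?c ^ (L choose 2)"
        using L by (simp add: mult.assoc)
    next
      have "?c ^ (Suc (Suc N) choose 2) \<le> ?c ^ N"
        using c choose_two_Suc_ge[of "Suc N"] by (intro power_decreasing) auto
      then have "norm (?E (Suc N)) \<le> C * ?c ^ N"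
        using C(1) C(2)[of "Suc N"] by (meson mult_left_mono less_imp_le order_trans)
      moreover have "norm (?v (Suc N) (Suc N)) \<le> G * B"
        unfolding norm_mult using G(1) B(1) nn by (intro mult_mono) auto
      ultimately show "norm (?E (Suc N)) * norm (?v (Suc N) (Suc N)) \<le> C * ?c ^ N * (G * B)"
        using C(1) by (intro mult_mono) auto
    qed
    also have "\<dots> = C * (3 * G * B) * ?c ^ N * (\<Sum>L\<le>N. ?c ^ (L choose 2)) + C * ?c ^ N * (G * B)"
      by (simp add: sum_distrib_left)
    also have "\<dots> \<le> C * (3 * G * B) * ?c ^ N * (1 / (?c * (1 - ?c))) + C * ?c ^ N * (G * B)"
      using C(1) nn c sm by (intro add_mono mult_left_mono) auto
    also have "\<dots> = D * ?c ^ N" by (simp add: D_def algebra_simps)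
    finally show ?thesis .
  qed
  show ?thesis
  \<comment> \<open>\<open>main\<close> bounds index \<open>Suc N\<close> by the power
    \<open>N\<close>, which costs a division by \<open>?c\<close>; the first summand covers
    \<open>K = 0\<close>.\<close>
  proof (intro exI[of _ "norm (alpha p a 0) + D / ?c"] allI)
    fix K
    have D0: "D \<ge> 0" unfolding D_def using C(1) nn c by (intro add_nonneg_nonneg mult_nonneg_nonneg) auto
    show "norm (alpha p a K) \<le> (norm (alpha p a 0) + D / ?c) * ?c ^ K"
    proof (cases K)
      case 0
      then show ?thesis using D0 c by simp
    next
      case (Suc N)
      have "D * ?c ^ N = D / ?c * ?c ^ K" using Suc c by simp
      moreover have "0 \<le> norm (alpha p a 0) * ?c ^ K" by simp
      ultimately show ?thesis using main[of N] Suc by (simp only: distrib_right)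
    qed
  qed
qed

section \<open>Absolute convergence\<close>

lemma double_choose_two: "2 * (v choose 2) + v = v * v"
  by (induction v) (simp_all add: choose_two_Suc numeral_2_eq_2)

lemma choose_two_add: "(u + v) choose 2 = (u choose 2) + (v choose 2) + u * v"
  by (induction v) (simp_all add: choose_two_Suc numeral_2_eq_2)

text \<open>Consecutive terms have ratio \<open>\<rho> * c ^ d\<close>, which tends to 0: the
  quadratic exponent beats every geometric growth.\<close>

lemma geom_choose_two_bounded:
  fixes c \<rho> :: real
  assumes c: "0 < c" "c < 1" and \<rho>: "0 < \<rho>"
  shows "\<exists>C>0. \<forall>d. \<rho> ^ d * c ^ (d choose 2) \<le> C"
proof -
  have "(\<lambda>d. \<rho> * c ^ d) \<longlonglongrightarrow> \<rho> * 0"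
    using c by (intro tendsto_intros LIMSEQ_realpow_zero) auto
  then have "\<forall>\<^sub>F d in sequentially. \<rho> * c ^ d < 1 / 2"
    by (rule order_tendstoD) simp
  then obtain N where N: "\<And>d. d \<ge> N \<Longrightarrow> \<rho> * c ^ d < 1 / 2"
    by (auto simp: eventually_sequentially)
  have "summable (\<lambda>d. \<rho> ^ d * c ^ (d choose 2))"
  proof (rule summable_ratio_test[where c = "1 / 2" and N = N])
    fix d assume "N \<le> d"
    have "norm (\<rho> ^ Suc d * c ^ (Suc d choose 2)) = (\<rho> * c ^ d) * norm (\<rho> ^ d * c ^ (d choose 2))"
      using c \<rho> by (simp add: choose_two_Suc power_add abs_mult)
    also have "\<dots> \<le> 1 / 2 * norm (\<rho> ^ d * c ^ (d choose 2))"
      using N[OF \<open>N \<le> d\<close>] by (intro mult_right_mono) auto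
    finally show "norm (\<rho> ^ Suc d * c ^ (Suc d choose 2)) \<le> 1 / 2 * norm (\<rho> ^ d * c ^ (d choose 2))" .
  qed simp
  then have "Bseq (\<lambda>d. \<rho> ^ d * c ^ (d choose 2))"
    by (intro convergent_imp_Bseq) (auto simp: convergent_def dest: summable_LIMSEQ_zero)
  then obtain K where K: "K > 0" "\<And>d. norm (\<rho> ^ d * c ^ (d choose 2)) \<le> K" by (auto simp: Bseq_def)
  have "\<rho> ^ d * c ^ (d choose 2) \<le> K" for d
    using K(2)[of d] by (metis abs_le_D1 real_norm_def)
  then show ?thesis using K(1) by blast
qed

text \<open>The difference is at most a multiple of \<open>norm p ^ v\<close>, and this
  \<open>v\<close> is what completes the two binomials to \<open>(d choose 2) + (v + d) * v\<close>.
  The part in \<open>d\<close> absorbs \<open>\<rho> ^ d\<close>.\<close>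

lemma pair_bound_aux:
  fixes p x y :: complex and \<rho> :: real
  assumes p: "0 < norm p" "norm p < 1" and \<rho>: "0 < \<rho>"
  shows "\<exists>D\<ge>0. \<forall>v d. norm (x * p ^ (v + d) - y * p ^ v) * norm p ^ (((v + d) choose 2) + (v choose 2)) * \<rho> ^ d
            \<le> D * norm p ^ ((v + d) * v)"
proof -
  let ?c = "norm p"
  obtain C where C: "C > 0" "\<And>d. \<rho> ^ d * ?c ^ (d choose 2) \<le> C"
    using geom_choose_two_bounded[OF p \<rho>] by blast
  have "norm (x * p ^ (v + d) - y * p ^ v) * ?c ^ (((v + d) choose 2) + (v choose 2)) * \<rho> ^ d
            \<le> (norm x + norm y) * C * ?c ^ ((v + d) * v)" for v d
  proof -
    have "norm (x * p ^ (v + d) - y * p ^ v) \<le> norm (x * p ^ (v + d)) + norm (y * p ^ v)"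
      by (rule norm_triangle_ineq4)
    also have "\<dots> \<le> norm x * ?c ^ v + norm y * ?c ^ v"
      unfolding norm_mult norm_power using p
      by (intro add_mono mult_left_mono power_decreasing) auto
    finally have 1: "norm (x * p ^ (v + d) - y * p ^ v) \<le> (norm x + norm y) * ?c ^ v"
      by (simp add: distrib_right)
    have 2: "v + (((v + d) choose 2) + (v choose 2)) = (d choose 2) + (v + d) * v"
      using double_choose_two[of v] by (simp add: choose_two_add algebra_simps)
    have "norm (x * p ^ (v + d) - y * p ^ v) * ?c ^ (((v + d) choose 2) + (v choose 2)) * \<rho> ^ d
       \<le> (norm x + norm y) * ?c ^ v * ?c ^ (((v + d) choose 2) + (v choose 2)) * \<rho> ^ d"
      using 1 \<rho> by (intro mult_right_mono) auto
    also have "\<dots> = (norm x + norm y) * (\<rho> ^ d * ?c ^ (d choose 2)) * ?c ^ ((v + d) * v)"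
      unfolding mult.assoc power_add[symmetric] 2 by (simp add: power_add mult_ac)
    also have "\<dots> \<le> (norm x + norm y) * C * ?c ^ ((v + d) * v)"
      using C by (intro mult_right_mono mult_left_mono) auto
    finally show ?thesis .
  qed
  then show ?thesis using C(1) by (intro exI[of _ "(norm x + norm y) * C"]) auto
qed

text \<open>The case \<open>u < v\<close> follows from the other one by exchanging \<open>x\<close>
  with \<open>y\<close> and \<open>\<rho>\<close> with \<open>1 / \<rho>\<close>.\<close>

lemma pair_bound:
  fixes p x y :: complex and \<rho> :: real
  assumes p: "0 < norm p" "norm p < 1" and \<rho>: "0 < \<rho>"
  shows "\<exists>D\<ge>0. \<forall>u v. norm (x * p ^ u - y * p ^ v) * norm p ^ ((u choose 2) + (v choose 2)) * \<rho> powi (int u - int v)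
            \<le> D * norm p ^ (u * v)"
proof -
  obtain D1 where D1: "D1 \<ge> 0" "\<And>v d. norm (x * p ^ (v + d) - y * p ^ v) * norm p ^ (((v + d) choose 2) + (v choose 2)) * \<rho> ^ d
            \<le> D1 * norm p ^ ((v + d) * v)"
    using pair_bound_aux[OF p \<rho>] by blast
  have "0 < 1 / \<rho>" using \<rho> by simp
  then obtain D2 where D2: "D2 \<ge> 0" "\<And>v d. norm (y * p ^ (v + d) - x * p ^ v) * norm p ^ (((v + d) choose 2) + (v choose 2)) * (1 / \<rho>) ^ d
            \<le> D2 * norm p ^ ((v + d) * v)"
    using pair_bound_aux[OF p, of "1 / \<rho>"] by blast
  have "norm (x * p ^ u - y * p ^ v) * norm p ^ ((u choose 2) + (v choose 2)) * \<rho> powi (int u - int v)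
            \<le> max D1 D2 * norm p ^ (u * v)" for u v
  proof (cases "v \<le> u")
    case True
    then obtain d where d: "u = v + d" using le_Suc_ex by blast
    have "D1 * norm p ^ ((v + d) * v) \<le> max D1 D2 * norm p ^ ((v + d) * v)"
      by (intro mult_right_mono) auto
    then show ?thesis using D1(2)[of v d] unfolding d by simp
  next
    case False
    then obtain d where d: "v = u + d" using le_Suc_ex nat_le_linear by blast
    have "\<rho> powi (int u - int v) = (1 / \<rho>) ^ d"
      unfolding d by (simp add: power_int_minus divide_simps)
    moreover have "D2 * norm p ^ ((u + d) * u) \<le> max D1 D2 * norm p ^ ((u + d) * u)"
      by (intro mult_right_mono) auto
    ultimately show ?thesis
      using D2(2)[of u d] unfolding d by (simp add: norm_minus_commute add.commute mult.commute)
  qed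
  then show ?thesis using D1(1) by (intro exI[of _ "max D1 D2"]) auto
qed

text \<open>
  The exponent \<open>n * (\<Sum>r. k r choose 2) - (|k| choose 2)\<close> splits into contributions
  \<open>(\<bar>k r - k s\<bar> choose 2) - min (k r) (k s)\<close> of the pairs \<open>r < s\<close>. The second part is compensated by the
  Vandermonde factor, and the first one dominates the powers of \<open>x r / x s\<close>.
\<close>

lemma vdm_bound:
  fixes p :: complex and x :: "nat \<Rightarrow> complex" and X :: "nat \<Rightarrow> real"
  assumes p: "0 < norm p" "norm p < 1" and X: "\<And>r. 0 < X r"
  shows "\<exists>C\<ge>0. \<forall>k. norm (vdm n (\<lambda>r. x r * p ^ k r)) * norm p ^ (n * (\<Sum>r=1..n. k r choose 2)) *
           (\<Prod>r=1..n. X r powi (int (n * k r) - int (mi_size n k))) \<le> C * norm p ^ (mi_size n k choose 2)"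
proof (induction n)
  case 0
  then show ?case by (intro exI[of _ 1]) (simp add: vdm_def mi_size_def numeral_2_eq_2)
next
  case (Suc n)
  let ?c = "norm p"
  let ?V = "\<lambda>n k. norm (vdm n (\<lambda>r. x r * p ^ k r))"
  let ?P = "\<lambda>n k. \<Prod>r=1..n. X r powi (int (n * k r) - int (mi_size n k))"
  let ?S = "\<lambda>n k. \<Sum>r=1..n. k r choose 2"
  obtain C where C: "C \<ge> 0" "\<And>k. ?V n k * ?c ^ (n * ?S n k) * ?P n k \<le> C * ?c ^ (mi_size n k choose 2)"
    using Suc.IH by blast
  \<comment> \<open>All that the indices \<open>r\<close> and \<open>Suc n\<close> contribute
    jointly when \<open>u = k r\<close> and \<open>v = k (Suc n)\<close>.\<close>
  let ?pair = "\<lambda>r u v. norm (x r * p ^ u - x (Suc n) * p ^ v) * ?c ^ ((u choose 2) + (v choose 2)) * (X r / X (Suc n)) powi (int u - int v)"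
  have "\<forall>r. \<exists>D\<ge>0. \<forall>u v. ?pair r u v \<le> D * ?c ^ (u * v)"
    using X by (intro allI pair_bound p divide_pos_pos)
  then obtain D where D: "\<And>r. D r \<ge> 0" "\<And>r u v. ?pair r u v \<le> D r * ?c ^ (u * v)"
    by metis
  have "?V (Suc n) k * ?c ^ (Suc n * ?S (Suc n) k) * ?P (Suc n) k \<le>
      C * (\<Prod>r=1..n. D r) * ?c ^ (mi_size (Suc n) k choose 2)" for k
  proof -
    let ?v = "k (Suc n)" and ?K = "mi_size n k"
    have K: "mi_size (Suc n) k = ?K + ?v" by (simp add: mi_size_def)
    have V: "?V (Suc n) k = ?V n k * (\<Prod>r=1..n. norm (x r * p ^ k r - x (Suc n) * p ^ ?v))"
      by (simp add: vdm_Suc norm_mult prod_norm)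
    have S: "?c ^ (Suc n * ?S (Suc n) k) = ?c ^ (n * ?S n k) * ?c ^ (?v choose 2) *
        (\<Prod>r=1..n. ?c ^ ((k r choose 2) + (?v choose 2)))"
    proof -
      have "Suc n * ?S (Suc n) k = n * ?S n k + (?v choose 2) + (\<Sum>r=1..n. (k r choose 2) + (?v choose 2))"
        by (simp add: sum.distrib algebra_simps)
      then show ?thesis by (simp only: power_add power_sum)
    qed
    \<comment> \<open>The exponent of \<open>X r\<close> grows by \<open>k r - ?v\<close>, and that
      of \<open>X (Suc n)\<close> is the sum of all \<open>?v - k r\<close>; together they give
      powers of \<open>X r / X (Suc n)\<close>.\<close>
    have P: "?P (Suc n) k = ?P n k * (\<Prod>r=1..n. (X r / X (Suc n)) powi (int (k r) - int ?v))"
    proof -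
      have X0: "X r \<noteq> 0" for r using X[of r] by simp
      have "X (Suc n) powi (int (Suc n * ?v) - int (mi_size (Suc n) k)) =
          (\<Prod>r=1..n. X (Suc n) powi (int ?v - int (k r)))"
      proof -
        have "int (Suc n * ?v) - int (mi_size (Suc n) k) = (\<Sum>r=1..n. int ?v - int (k r))"
          by (simp add: K mi_size_def sum_subtractf)
        moreover have "X (Suc n) powi (\<Sum>r\<in>A. f r) = (\<Prod>r\<in>A. X (Suc n) powi f r)" if "finite A"
          for f and A :: "nat set"
          using that by (induction A rule: finite_induct) (auto simp: power_int_add X0)
        ultimately show ?thesis by simp
      qed
      moreover have "X r powi (int (Suc n * k r) - int (mi_size (Suc n) k)) * X (Suc n) powi (int ?v - int (k r)) =
          X r powi (int (n * k r) - int ?K) * (X r / X (Suc n)) powi (int (k r) - int ?v)" for r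
      proof -
        have a: "int (Suc n * k r) - int (mi_size (Suc n) k) = (int (n * k r) - int ?K) + (int (k r) - int ?v)"
          by (simp add: K)
        have b: "X (Suc n) powi (int ?v - int (k r)) = 1 / X (Suc n) powi (int (k r) - int ?v)"
          using power_int_minus_divide[of "X (Suc n)" "int (k r) - int ?v"] by simp
        show ?thesis
          unfolding a b power_int_divide_distrib using X0 by (subst power_int_add) auto
      qed
      ultimately show ?thesis
        by (simp add: prod.distrib[symmetric])
    qed
    have "?V (Suc n) k * ?c ^ (Suc n * ?S (Suc n) k) * ?P (Suc n) k =
        (?V n k * ?c ^ (n * ?S n k) * ?P n k) * ?c ^ (?v choose 2) * (\<Prod>r=1..n. ?pair r (k r) ?v)"
      unfolding V S P prod.distrib by (simp only: mult_ac)
    also have "\<dots> \<le> (C * ?c ^ (?K choose 2)) * ?c ^ (?v choose 2) * (\<Prod>r=1..n. D r * ?c ^ (k r * ?v))"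
    proof (rule mult_mono[OF mult_right_mono[OF C(2)] prod_mono])
      have pos: "0 \<le> ?pair r (k r) ?v" for r
        using X by (intro mult_nonneg_nonneg zero_le_power_int) (auto intro: less_imp_le)
      then show "0 \<le> (\<Prod>r=1..n. ?pair r (k r) ?v)" by (intro prod_nonneg) auto
      show "0 \<le> ?pair r (k r) ?v \<and> ?pair r (k r) ?v \<le> D r * ?c ^ (k r * ?v)" for r
        using pos D(2) by blast
    qed (use C(1) in auto)
    also have "\<dots> = C * (\<Prod>r=1..n. D r) * ?c ^ (mi_size (Suc n) k choose 2)"
    proof -
      have "(\<Prod>r=1..n. ?c ^ (k r * ?v)) = ?c ^ (?K * ?v)"
        by (simp add: mi_size_def sum_distrib_right power_sum)
      then show ?thesis
        unfolding K choose_two_add power_add prod.distrib by (simp only: mult_ac)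
    qed
    finally show ?thesis .
  qed
  moreover have "0 \<le> C * (\<Prod>r=1..n. D r)" using C(1) D(1) by (intro mult_nonneg_nonneg prod_nonneg) auto
  ultimately show ?case by blast
qed

section \<open>Bounds for the terms of the multiple series\<close>

text \<open>\<open>vdm_bound\<close> controls numerator and Vandermonde factor, while each inverse
  denominator factor converges and is therefore bounded uniformly in \<open>k\<close>.\<close>

lemma milne_confluent_bound:
  assumes g: "generic n p x" and p: "norm p < 1"
  shows "\<exists>C\<ge>0. \<forall>k. norm (milne_term n p x (\<lambda>s. 1 / x s) (\<lambda>_. 0) k) \<le> C * norm p ^ (mi_size n k choose 2)"
proof -
  have p0: "0 < norm p" and x0: "\<forall>r\<in>{1..n}. x r \<noteq> 0" using g by (auto simp: generic_def)
  \<comment> \<open>The default 1 makes \<open>?X\<close> positive at every index, as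
    \<open>vdm_bound\<close> demands; on \<open>{1..n}\<close> it is
    \<open>norm (x r)\<close>.\<close>
  let ?X = "\<lambda>r. if x r = 0 then 1 else norm (x r)"
  have X: "0 < ?X r" for r by simp
  obtain C where C: "C \<ge> 0" "\<And>k. norm (vdm n (\<lambda>r. x r * p ^ k r)) * norm p ^ (n * (\<Sum>r=1..n. k r choose 2)) *
           (\<Prod>r=1..n. ?X r powi (int (n * k r) - int (mi_size n k))) \<le> C * norm p ^ (mi_size n k choose 2)"
    using vdm_bound[where X = ?X and n = n and x = x, OF p0 p X] by blast
  have "\<forall>r\<in>{1..n}. \<forall>s\<in>{1..n}. \<exists>B. \<forall>j. norm (1 / qpoch (p * (x r / x s)) p j) \<le> B"
    using inverse_qpoch_bounded[OF p generic_qpoch_nonzero[OF g]] by blast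
  then obtain B where B: "\<And>r s j. r \<in> {1..n} \<Longrightarrow> s \<in> {1..n} \<Longrightarrow> norm (1 / qpoch (p * (x r / x s)) p j) \<le> B r s"
    by metis
  define E where "E = (\<Prod>r=1..n. \<Prod>s=1..n. B r s)"
  have E: "norm (1 / milne_den n p x k) \<le> E" for k
  proof -
    have "norm (1 / milne_den n p x k) = (\<Prod>r=1..n. \<Prod>s=1..n. norm (1 / qpoch (p * (x r / x s)) p (k r)))"
      by (simp add: milne_den_def norm_divide prod_norm[symmetric] prod_dividef)
    also have "\<dots> \<le> E"
      unfolding E_def by (intro prod_mono conjI prod_nonneg B norm_ge_zero ballI)
    finally show ?thesis .
  qed
  have E0: "E \<ge> 0" using E[of undefined] norm_ge_zero order_trans by blast
  have "norm (milne_term n p x (\<lambda>s. 1 / x s) (\<lambda>_. 0) k) \<le> C * E / norm (vdm n x) * norm p ^ (mi_size n k choose 2)" for k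
  proof -
    have "(\<Prod>r=1..n. norm (x r) powi (int (n * k r) - int (mi_size n k))) =
        (\<Prod>r=1..n. ?X r powi (int (n * k r) - int (mi_size n k)))"
      using x0 by (intro prod.cong) auto
    then have "norm (milne_num n p x (\<lambda>s. 1 / x s) (\<lambda>_. 0) k) = norm p ^ (n * (\<Sum>r=1..n. k r choose 2)) *
        (\<Prod>r=1..n. ?X r powi (int (n * k r) - int (mi_size n k)))"
      unfolding milne_num_confluent[OF x0] by (simp only: norm_mult norm_power prod_norm[symmetric] norm_power_int) simp
    then have "norm (milne_term n p x (\<lambda>s. 1 / x s) (\<lambda>_. 0) k) =
       (norm (vdm n (\<lambda>r. x r * p ^ k r)) * norm p ^ (n * (\<Sum>r=1..n. k r choose 2)) *
           (\<Prod>r=1..n. ?X r powi (int (n * k r) - int (mi_size n k)))) * norm (1 / milne_den n p x k) / norm (vdm n x)"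
      unfolding milne_term_def by (simp only: norm_mult norm_divide) (simp add: mult_ac)
    also have "\<dots> \<le> C * norm p ^ (mi_size n k choose 2) * E / norm (vdm n x)"
      using C(1) by (intro divide_right_mono mult_mono[OF C(2) E]) auto
    finally show ?thesis by (simp add: mult_ac)
  qed
  then show ?thesis using C(1) E0 by (intro exI[of _ "C * E / norm (vdm n x)"]) auto
qed

text \<open>The bound for the Milne summand has the same factor
  \<open>norm p ^ (K choose 2)\<close>, with \<open>p = q\<^sup>2\<close>, that occurs in
  \<open>alpha\<close>. Hence the decay of \<open>alpha\<close> passes to every single term, not
  only to the sum over a fixed size.\<close>

lemma outer_term_bound:
  assumes g: "generic n (q\<^sup>2) x" and q: "norm q < 1"
  shows "\<exists>C. \<forall>k. norm (outer_term n w q x k) \<le> C * norm (q\<^sup>2) ^ mi_size n k"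
proof -
  let ?p = "q\<^sup>2"
  have p: "norm ?p < 1" "?p \<noteq> 0" using q g by (auto simp: norm_power power_less_one_iff generic_def)
  obtain C where C: "C \<ge> 0" "\<And>k. norm (milne_term n ?p x (\<lambda>s. 1 / x s) (\<lambda>_. 0) k) \<le> C * norm ?p ^ (mi_size n k choose 2)"
    using milne_confluent_bound[OF g p(1)] by blast
  obtain A where A: "\<And>K. norm (alpha ?p q K) \<le> A * norm ?p ^ K" using alpha_bound[OF p] by blast
  obtain B where B: "B > 0" "\<And>K. norm (qpoch ?p ?p K) \<le> B" using qpoch_bounded[OF p(1)] by blast
  have "norm (outer_term n w q x k) \<le> C * A * B / norm w * norm ?p ^ mi_size n k" for k
  proof -
    let ?K = "mi_size n k"
    define Y where "Y = (1 - q * ?p ^ (2 * ?K)) * qpoch q ?p ?K * inner_1d ?p q ?K"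
    have "alpha ?p q ?K * qpoch ?p ?p ?K = (-1) ^ ?K * ?p ^ (?K choose 2) * Y"
      using qpoch_self_nonzero[OF p(1)] by (simp add: alpha_def Y_def)
    then have "norm ?p ^ (?K choose 2) * norm Y = norm (alpha ?p q ?K) * norm (qpoch ?p ?p ?K)"
      by (metis (no_types, opaque_lifting) mult_1 norm_minus_cancel norm_mult norm_one norm_power power_one)
    also have "\<dots> \<le> A * norm ?p ^ ?K * B"
      using A[of ?K] B order_trans[OF norm_ge_zero A[of ?K]] by (intro mult_mono) auto
    finally have Y: "norm ?p ^ (?K choose 2) * norm Y \<le> A * norm ?p ^ ?K * B" .
    have "norm (outer_term n w q x k) = norm (milne_term n ?p x (\<lambda>s. 1 / x s) (\<lambda>_. 0) k) * norm Y / norm w"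
      unfolding outer_term_eq[OF g] Y_def by (simp only: norm_mult norm_divide) simp
    also have "\<dots> \<le> C * norm ?p ^ (?K choose 2) * norm Y / norm w"
      using C by (intro divide_right_mono mult_right_mono) auto
    also have "\<dots> \<le> C * (A * norm ?p ^ ?K * B) / norm w"
      unfolding mult.assoc using Y C by (intro divide_right_mono mult_left_mono) (auto simp: mult.assoc)
    finally show ?thesis by (simp add: mult_ac)
  qed
  then show ?thesis by blast
qed

section \<open>Summation of the multiple series\<close>

lemma summable_on_power_mi_size:
  fixes c :: real
  assumes "0 \<le> c" "c < 1"
  shows "(\<lambda>k. c ^ mi_size n k) summable_on multi_indices n"
proof -
  have "Infinite_Set_Sum.abs_summable_on (\<lambda>k. \<Prod>r\<in>{1..n}. c ^ k r) (multi_indices n)"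
    unfolding multi_indices_def
  proof (rule abs_summable_on_prod_PiE)
    show "Infinite_Set_Sum.abs_summable_on ((^) c) UNIV"
      using assms by (simp add: abs_summable_on_nat_iff' summable_geometric norm_power)
  qed auto
  then have "(\<lambda>k. norm (\<Prod>r\<in>{1..n}. c ^ k r)) summable_on multi_indices n"
    unfolding abs_summable_equivalent .
  moreover have "norm (\<Prod>r\<in>{1..n}. c ^ k r) = c ^ mi_size n k" for k
    using assms(1) by (simp add: mi_size_def power_sum abs_prod power_abs)
  ultimately show ?thesis by simp
qed

lemma has_sum_outer_term:
  assumes g: "generic n (q\<^sup>2) x" and q: "norm q < 1" and n: "n \<ge> 1"
  shows "(outer_term n w q x has_sum
           ((qpoch_inf q (q\<^sup>2))\<^sup>2 / (qpoch_inf (q\<^sup>2) (q\<^sup>2))\<^sup>2 / w)) (multi_indices n)"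
proof -
  let ?p = "q\<^sup>2"
  have p: "norm ?p < 1" "?p \<noteq> 0" using q g by (auto simp: norm_power power_less_one_iff generic_def)
  obtain C where C: "\<And>k. norm (outer_term n w q x k) \<le> C * norm ?p ^ mi_size n k"
    using outer_term_bound[OF g q] by blast
  have "(\<lambda>k. C * norm ?p ^ mi_size n k) summable_on multi_indices n"
    by (intro summable_on_cmult_right summable_on_power_mi_size p) simp
  then have "(\<lambda>k. norm (outer_term n w q x k)) summable_on multi_indices n"
    by (rule summable_on_comparison_test) (use C in auto)
  then have "outer_term n w q x summable_on multi_indices n"
    by (rule abs_summable_summable)
  then obtain S where S: "(outer_term n w q x has_sum S) (multi_indices n)"
    by (auto simp: summable_on_def)
  \<comment> \<open>Tagging each multi-index with its size prepares the grouping into finite sums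
    over \<open>comps n K\<close>.\<close>
  then have "((\<lambda>(K, k). outer_term n w q x k) has_sum S) (Sigma UNIV (comps n))"
    by (subst has_sum_reindex_bij_witness[where i = "\<lambda>k. (mi_size n k, k)" and j = snd
          and T = "multi_indices n" and h = "outer_term n w q x" and s' = S])
       (auto simp: comps_def)
  then have "((\<lambda>K. \<Sum>k\<in>comps n K. outer_term n w q x k) has_sum S) UNIV"
    by (rule has_sum_Sigma') (auto intro: has_sum_finiteI finite_comps)
  then have "(\<lambda>K. alpha ?p q K / w) sums S"
    unfolding sum_outer_term[OF g n] by (rule has_sum_imp_sums)
  moreover have "(\<lambda>K. alpha ?p q K / w) sums ((qpoch_inf q ?p)\<^sup>2 / (qpoch_inf ?p ?p)\<^sup>2 / w)"
    by (intro sums_divide sums_alpha p)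
  ultimately show ?thesis using S sums_unique2 by blast
qed

theorem theorem5p4:
  fixes q w :: complex and n :: nat and x :: "nat \<Rightarrow> complex"
  assumes "0 < norm q" and "norm q < 1" and "w ^ 4 = q" and "n \<ge> 1"
    and "\<And>r. r \<in> {1..n} \<Longrightarrow> x r \<noteq> 0"
    and "\<And>r s. r \<in> {1..n} \<Longrightarrow> s \<in> {1..n} \<Longrightarrow> r < s \<Longrightarrow> 1 - x r / x s \<noteq> 0"
    and "\<And>r s k. r \<in> {1..n} \<Longrightarrow> s \<in> {1..n} \<Longrightarrow> qpoch (q\<^sup>2 * (x r / x s)) (q\<^sup>2) k \<noteq> 0"
  shows "outer_term n w q x summable_on multi_indices n \<and>
    1 / q_pi w q = 1 / (1 - q\<^sup>2) * (\<Sum>\<^sub>\<infinity>k\<in>multi_indices n. outer_term n w q x k)"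
proof -
  let ?p = "q\<^sup>2"
  have p: "norm ?p < 1" "?p \<noteq> 0" using assms(1,2) by (auto simp: norm_power power_less_one_iff)
  \<comment> \<open>Genericity is recovered from the nonvanishing denominators: equal exponents
    contradict the Vandermonde denominators, and a gap of \<open>Suc j\<close> makes the factor with
    index \<open>j\<close> of a \<open>qpoch\<close> vanish.\<close>
  have le: "x r * ?p ^ u \<noteq> x s * ?p ^ v" if rs: "r \<in> {1..n}" "s \<in> {1..n}" "r \<noteq> s" and "v \<le> u" for r s u v
  proof
    assume eq: "x r * ?p ^ u = x s * ?p ^ v"
    obtain d where d: "u = v + d" using le_Suc_ex[OF \<open>v \<le> u\<close>] by blast
    have x0: "x r \<noteq> 0" "x s \<noteq> 0" using rs assms(5) by auto
    have e: "x r * ?p ^ d = x s" using eq p by (simp add: d power_add)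
    show False
    proof (cases d)
      case 0
      then have "x r = x s" using e by simp
      then show False
        using assms(6)[of r s] assms(6)[of s r] rs x0 by (cases "r < s") auto
    next
      case (Suc j)
      then have "?p * (x r / x s) * ?p ^ j = 1" using e x0 by (simp add: field_simps)
      then have "qpoch (?p * (x r / x s)) ?p (Suc j) = 0" by (simp add: qpoch_Suc)
      then show False using assms(7) rs by blast
    qed
  qed
  have g: "generic n ?p x"
    unfolding generic_def
  proof (intro conjI ballI allI impI)
    fix r s u v assume "r \<in> {1..n}" "s \<in> {1..n}" "r \<noteq> s"
    then show "x r * ?p ^ u \<noteq> x s * ?p ^ v"
      using le[of r s v u] le[of s r u v] by (metis nat_le_linear)
  qed (use p assms(5) power_ne_1 in auto)
  have "(\<Sum>\<^sub>\<infinity>k\<in>multi_indices n. outer_term n w q x k) = (qpoch_inf q ?p)\<^sup>2 / (qpoch_inf ?p ?p)\<^sup>2 / w"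
    by (rule infsumI[OF has_sum_outer_term[OF g assms(2,4)]])
  then show ?thesis
    using has_sum_outer_term[OF g assms(2,4), of w]
    by (auto simp: summable_on_def q_pi_def)
qed

end
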